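(* Let $a=1$, $b=-1$. The map $\Psi:D_1\to\tilde D$, $\Psi(J,E)=(\tilde M(J,E),\tilde P(J,E))$, is a diffeomorphism, where $$\tilde D=\Big\{(\tilde M,\tilde P)\in\mathbb{R}^2:\ \tilde M>0,\ 0<\tilde P<\frac{\tilde M}{\pi}\sqrt{3\tilde M^2+\pi^2-\sqrt{9\tilde M^4+4\tilde M^2\pi^2}}\Big\}.$$
   Context: With $a=1$, $b=-1$ (defocusing cubic NLS $i\psi_t+\psi_{xx}-|\psi|^2\psi=0$, standing waves $e^{-it}u(x)$ with $u_{xx}+u-|u|^2u=0$), let $J=\operatorname{Im}(u\bar u_x)$, $E=\frac12|u_x|^2+\frac12|u|^2-\frac14|u|^4$, and $V_J(r)=\frac{J^2}{2r^2}+\frac{r^2}{2}-\frac{r^4}{4}$. For $0<J<\sqrt{4/27}$ write $J=q(1-q^2)=Q(1-Q^2)$ with $0<q<1/\sqrt3<Q<1$, and set $E_-(J)=\frac14(1-Q^2)(3Q^2+1)$, $E_+(J)=\frac14(1-q^2)(3q^2+1)$. Let $D_1=\{(J,E):0<J<\sqrt{4/27},\ E_-(J)<E<E_+(J)\}$. For $(J,E)\in D_1$, let $r_1<r_2<r_3$ be the positive roots of $E-V_J(r)$ and define $T(J,E)=2\int_{r_1}^{r_2}\frac{dr}{\sqrt{2(E-V_J(r))}}$, $\tilde M(J,E)=\int_{r_1}^{r_2}\frac{r^2\,dr}{\sqrt{2(E-V_J(r))}}$ and $\tilde P(J,E)=\frac12 J\,T(J,E)$ (the period, mass $\frac12\int_0^T|u|^2$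 and momentum $\frac12\operatorname{Im}\int_0^T u\bar u_x$ of the corresponding solution). *)

theory Defs
  imports "HOL-Analysis.Analysis"
begin

text \<open>Defocusing cubic NLS case a = 1, b = -1.  Points of the plane are pairs real * real.\<close>

definition VJ :: "real \<Rightarrow> real \<Rightarrow> real" where
  "VJ J r = J^2 / (2 * r^2) + r^2 / 2 - r^4 / 4"

definition Jmax :: real where "Jmax = sqrt (4/27)"

definition small_q :: "real \<Rightarrow> real" where
  "small_q J = (THE q. 0 < q \<and> q < 1 / sqrt 3 \<and> J = q * (1 - q^2))"

definition big_Q :: "real \<Rightarrow> real" where
  "big_Q J = (THE Q. 1 / sqrt 3 < Q \<and> Q < 1 \<and> J = Q * (1 - Q^2))"

definition E_minus :: "real \<Rightarrow> real" where
  "E_minus J = (1/4) * (1 - (big_Q J)^2) * (3 * (big_Q J)^2 + 1)"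

definition E_plus :: "real \<Rightarrow> real" where
  "E_plus J = (1/4) * (1 - (small_q J)^2) * (3 * (small_q J)^2 + 1)"

definition D1 :: "(real \<times> real) set" where
  "D1 = {(J, E). 0 < J \<and> J < Jmax \<and> E_minus J < E \<and> E < E_plus J}"

definition pos_roots :: "real \<Rightarrow> real \<Rightarrow> real list" where
  "pos_roots J E = sorted_list_of_set {r. 0 < r \<and> E - VJ J r = 0}"

definition r1 :: "real \<Rightarrow> real \<Rightarrow> real" where "r1 J E = pos_roots J E ! 0"
definition r2 :: "real \<Rightarrow> real \<Rightarrow> real" where "r2 J E = pos_roots J E ! 1"

definition period_T :: "real \<Rightarrow> real \<Rightarrow> real" where
  "period_T J E = 2 * integral {r1 J E .. r2 J E} (\<lambda>r. 1 / sqrt (2 * (E - VJ J r)))"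

definition mass_M :: "real \<Rightarrow> real \<Rightarrow> real" where
  "mass_M J E = integral {r1 J E .. r2 J E} (\<lambda>r. r^2 / sqrt (2 * (E - VJ J r)))"

definition momentum_P :: "real \<Rightarrow> real \<Rightarrow> real" where
  "momentum_P J E = (1/2) * J * period_T J E"

definition Psi :: "real \<times> real \<Rightarrow> real \<times> real" where
  "Psi = (\<lambda>(J, E). (mass_M J E, momentum_P J E))"

definition D_tilde :: "(real \<times> real) set" where
  "D_tilde = {(M, P). 0 < M \<and> 0 < P \<and>
      P < M / pi * sqrt (3 * M^2 + pi^2 - sqrt (9 * M^4 + 4 * M^2 * pi^2))}"

fun Ck_on :: "nat \<Rightarrow> (real \<times> real) set \<Rightarrow> (real \<times> real \<Rightarrow> real) \<Rightarrow> bool" where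
  "Ck_on 0 S g = continuous_on S g"
| "Ck_on (Suc k) S g = (\<exists>g1 g2. (\<forall>x\<in>S. (g has_derivative (\<lambda>h. fst h * g1 x + snd h * g2 x)) (at x))
                                 \<and> Ck_on k S g1 \<and> Ck_on k S g2)"

definition smooth_on :: "(real \<times> real) set \<Rightarrow> (real \<times> real \<Rightarrow> real \<times> real) \<Rightarrow> bool" where
  "smooth_on S f = (\<forall>k. Ck_on k S (\<lambda>x. fst (f x)) \<and> Ck_on k S (\<lambda>x. snd (f x)))"

definition diffeomorphism_on :: "(real \<times> real) set \<Rightarrow> (real \<times> real) set \<Rightarrow> (real \<times> real \<Rightarrow> real \<times> real) \<Rightarrow> bool" where
  "diffeomorphism_on S T f = (inj_on f S \<and> f ` S = T \<and> smooth_on S f \<and> smooth_on T (inv_into S f))"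

end

theory Submission
  imports Defs
begin

text \<open>
  With \<open>s = r\<^sup>2\<close>, the equation \<open>E = VJ J r\<close> is a cubic in \<open>s\<close> with roots \<open>s\<^sub>1 < s\<^sub>2 < s\<^sub>3\<close> of sum 2, and
  \<open>D1\<close> corresponds diffeomorphically to the triples with \<open>0 < s\<^sub>1\<close>. In the coordinates
  \<open>w = s\<^sub>1 / (s\<^sub>3 - s\<^sub>1) > 0\<close> and \<open>m = (s\<^sub>2 - s\<^sub>1) / (s\<^sub>3 - s\<^sub>1) \<in> (0, 1)\<close> the substitution
  \<open>s = s\<^sub>1 + (s\<^sub>2 - s\<^sub>1) sin\<^sup>2 t\<close> turns mass and momentum into algebraic functions of \<open>w\<close>, \<open>m\<close> and the complete
  elliptic integrals \<open>K(m)\<close>, \<open>E(m)\<close>. Their Jacobian has a sign, by \<open>(1 - m) K \<le> E \<le> (1 - m/2) K\<close>.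
  The mass increases in \<open>w\<close>, so each level set of the mass is a graph \<open>w = w(m)\<close> over an interval
  \<open>(0, m\<^sub>1)\<close>; along it the momentum decreases strictly from its limit at \<open>m = 0\<close>, which is the upper boundary of
  \<open>D_tilde\<close>, to 0. This gives bijectivity, and the inverse function theorem gives smoothness of the inverse.
\<close>

section \<open>Calculus of C^k functions on the plane\<close>

text \<open>A Jacobian without zeros gives only local inverses; monotonicity along the level curves
  of the mass is what makes the inverse global. One inequality, \<open>jacobian_G_pos\<close>,
  serves both purposes, since the derivative of the momentum along a level curve is minus that
  determinant divided by \<open>mass_G_dw\<close>. The coordinates are scale-free: the roots are
  proportional to \<open>w\<close>, \<open>w + m\<close>, \<open>w + 1\<close>, and their sum 2
  fixes the factor. Because \<open>m\<close> is the elliptic parameter itself, \<open>w\<close>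
  enters only algebraically, and K and E remain functions of one variable. The delicate points are
  the edges. The closed formulas for the derivatives of K and E divide by \<open>m\<close>, so that
  differentiation in \<open>m\<close> stops short of \<open>m = 0\<close> and the edge is reached by
  continuity. The period integrands blow up at both turning points, so that the substitution rests
  on an antiderivative that is merely continuous there. Finally, the bounds of \<open>D1\<close> are
  critical values defined by definite description; they are brought in through the sign of the cubic
  at its critical points.\<close>

lemma Ck_on_Suc_imp: "Ck_on (Suc k) S g \<Longrightarrow> Ck_on k S g"
proof (induction k arbitrary: g)
  case 0
  then obtain g1 g2 where "\<forall>x\<in>S. (g has_derivative (\<lambda>h. fst h * g1 x + snd h * g2 x)) (at x)"
    by auto
  then show ?case unfolding Ck_on.simps
    by (blast intro: continuous_at_imp_continuous_on has_derivative_continuous)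
next
  case (Suc k)
  from Suc.prems obtain g1 g2 where
    "\<forall>x\<in>S. (g has_derivative (\<lambda>h. fst h * g1 x + snd h * g2 x)) (at x)"
    "Ck_on (Suc k) S g1" "Ck_on (Suc k) S g2"
    unfolding Ck_on.simps(2)[of "Suc k"] by blast
  with Suc.IH[of g1] Suc.IH[of g2] show ?case
    unfolding Ck_on.simps(2)[of k] by blast
qed

lemma Ck_on_SucI:
  assumes "\<And>x. x \<in> S \<Longrightarrow> (g has_derivative (\<lambda>h. fst h * g1 x + snd h * g2 x)) (at x)"
    and "Ck_on k S g1" and "Ck_on k S g2"
  shows "Ck_on (Suc k) S g"
  unfolding Ck_on.simps using assms by blast

lemma Ck_on_SucE:
  assumes "Ck_on (Suc k) S g"
  obtains g1 g2 where "\<forall>x\<in>S. (g has_derivative (\<lambda>h. fst h * g1 x + snd h * g2 x)) (at x)"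
    and "Ck_on k S g1" and "Ck_on k S g2"
  using assms unfolding Ck_on.simps by blast

text \<open>The derivatives are taken \<open>at x\<close> in the full plane, so agreement on
  \<open>S\<close> determines them only because \<open>S\<close> is a neighbourhood of each of its
  points.\<close>

lemma Ck_on_cong:
  assumes "open S" "\<And>x. x \<in> S \<Longrightarrow> f x = g x" "Ck_on k S f"
  shows "Ck_on k S g"
proof (cases k)
  case 0
  with assms show ?thesis by (simp cong: continuous_on_cong)
next
  case (Suc j)
  obtain f1 f2 where
    d: "\<forall>x\<in>S. (f has_derivative (\<lambda>h. fst h * f1 x + snd h * f2 x)) (at x)"
    and *: "Ck_on j S f1" "Ck_on j S f2"
    using assms(3)[unfolded Suc] by (rule Ck_on_SucE)
  have "(g has_derivative (\<lambda>h. fst h * f1 x + snd h * f2 x)) (at x)" if "x \<in> S" for x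
    using has_derivative_transform_within_open[OF d[rule_format, OF that] assms(1) that] assms(2) by blast
  from Ck_on_SucI[OF this *] Suc show ?thesis by simp
qed

lemma Ck_on_const: "Ck_on k S (\<lambda>x. c)"
proof (induction k arbitrary: c)
  case (Suc k)
  show ?case
    by (rule Ck_on_SucI[where ?g1.0="\<lambda>_. 0" and ?g2.0="\<lambda>_. 0"])
      (simp_all add: Suc.IH)
qed auto

lemma Ck_on_fst: "Ck_on k S fst"
proof (cases k)
  case (Suc j)
  show ?thesis unfolding Suc
    by (rule Ck_on_SucI[where ?g1.0="\<lambda>_. 1" and ?g2.0="\<lambda>_. 0"])
      (simp_all add: Ck_on_const has_derivative_fst[OF has_derivative_ident])
qed (simp add: continuous_on_fst[OF continuous_on_id])

lemma Ck_on_snd: "Ck_on k S snd"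
proof (cases k)
  case (Suc j)
  show ?thesis unfolding Suc
    by (rule Ck_on_SucI[where ?g1.0="\<lambda>_. 0" and ?g2.0="\<lambda>_. 1"])
      (simp_all add: Ck_on_const has_derivative_snd[OF has_derivative_ident])
qed (simp add: continuous_on_snd[OF continuous_on_id])

lemma Ck_on_add:
  "Ck_on k S f \<Longrightarrow> Ck_on k S g \<Longrightarrow> Ck_on k S (\<lambda>x. f x + g x)"
proof (induction k arbitrary: f g)
  case 0
  then show ?case by (simp add: continuous_on_add)
next
  case (Suc k)
  obtain f1 f2 where f: "\<forall>x\<in>S. (f has_derivative (\<lambda>h. fst h * f1 x + snd h * f2 x)) (at x)"
    "Ck_on k S f1" "Ck_on k S f2" using Suc.prems(1) by (rule Ck_on_SucE)
  note fd = f(1)[rule_format]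
  obtain g1 g2 where g: "\<forall>x\<in>S. (g has_derivative (\<lambda>h. fst h * g1 x + snd h * g2 x)) (at x)"
    "Ck_on k S g1" "Ck_on k S g2" using Suc.prems(2) by (rule Ck_on_SucE)
  note gd = g(1)[rule_format]
  show ?case
  proof (rule Ck_on_SucI[where ?g1.0="\<lambda>x. f1 x + g1 x" and ?g2.0="\<lambda>x. f2 x + g2 x"])
    fix x assume "x \<in> S"
    then show "((\<lambda>x. f x + g x) has_derivative (\<lambda>h. fst h * (f1 x + g1 x) + snd h * (f2 x + g2 x))) (at x)"
      using has_derivative_add[OF fd gd] by (simp add: algebra_simps)
  qed (intro Suc.IH f(2,3) g(2,3))+
qed

lemma Ck_on_mult:
  "Ck_on k S f \<Longrightarrow> Ck_on k S g \<Longrightarrow> Ck_on k S (\<lambda>x. f x * g x)"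
proof (induction k arbitrary: f g)
  case 0
  then show ?case by (simp add: continuous_on_mult)
next
  case (Suc k)
  obtain f1 f2 where f: "\<forall>x\<in>S. (f has_derivative (\<lambda>h. fst h * f1 x + snd h * f2 x)) (at x)"
    "Ck_on k S f1" "Ck_on k S f2" using Suc.prems(1) by (rule Ck_on_SucE)
  note fd = f(1)[rule_format]
  obtain g1 g2 where g: "\<forall>x\<in>S. (g has_derivative (\<lambda>h. fst h * g1 x + snd h * g2 x)) (at x)"
    "Ck_on k S g1" "Ck_on k S g2" using Suc.prems(2) by (rule Ck_on_SucE)
  note gd = g(1)[rule_format]
  show ?case
  proof (rule Ck_on_SucI[where ?g1.0="\<lambda>x. f1 x * g x + f x * g1 x" and ?g2.0="\<lambda>x. f2 x * g x + f x * g2 x"])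
    fix x assume "x \<in> S"
    then show "((\<lambda>x. f x * g x) has_derivative
        (\<lambda>h. fst h * (f1 x * g x + f x * g1 x) + snd h * (f2 x * g x + f x * g2 x))) (at x)"
      using has_derivative_mult[OF fd gd] by (simp add: algebra_simps)
  qed (intro Ck_on_add Suc.IH f(2,3) g(2,3) Ck_on_Suc_imp[OF Suc.prems(1)] Ck_on_Suc_imp[OF Suc.prems(2)])+
qed

lemma Ck_on_minus: "Ck_on k S f \<Longrightarrow> Ck_on k S (\<lambda>x. - f x)"
  using Ck_on_mult[OF Ck_on_const[of k S "-1"]] by auto

lemma Ck_on_diff:
  "Ck_on k S f \<Longrightarrow> Ck_on k S g \<Longrightarrow> Ck_on k S (\<lambda>x. f x - g x)"
  using Ck_on_add[of k S f "\<lambda>x. - g x"] Ck_on_minus[of k S g] by simp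

lemma Ck_on_inverse:
  assumes "Ck_on k S f" "\<And>x. x \<in> S \<Longrightarrow> f x \<noteq> 0"
  shows "Ck_on k S (\<lambda>x. inverse (f x))"
  using assms(1)
proof (induction k)
  case 0
  then show ?case using assms(2) by (simp add: continuous_on_inverse)
next
  case (Suc k)
  obtain f1 f2 where f: "\<forall>x\<in>S. (f has_derivative (\<lambda>h. fst h * f1 x + snd h * f2 x)) (at x)"
    "Ck_on k S f1" "Ck_on k S f2" using Suc.prems(1) by (rule Ck_on_SucE)
  note fd = f(1)[rule_format]
  have i: "Ck_on k S (\<lambda>x. inverse (f x))" using Suc.IH Ck_on_Suc_imp Suc.prems by blast
  show ?case
  proof (rule Ck_on_SucI[where ?g1.0="\<lambda>x. - (inverse (f x) * inverse (f x) * f1 x)"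
          and ?g2.0="\<lambda>x. - (inverse (f x) * inverse (f x) * f2 x)"])
    fix x assume x: "x \<in> S"
    show "((\<lambda>x. inverse (f x)) has_derivative (\<lambda>h. fst h * - (inverse (f x) * inverse (f x) * f1 x)
        + snd h * - (inverse (f x) * inverse (f x) * f2 x))) (at x)"
      using Deriv.has_derivative_inverse[OF assms(2) fd, OF x x] by (simp add: algebra_simps)
  qed (intro Ck_on_minus Ck_on_mult i f(2,3))+
qed

lemma Ck_on_divide:
  assumes "Ck_on k S f" "Ck_on k S g" "\<And>x. x \<in> S \<Longrightarrow> g x \<noteq> 0"
  shows "Ck_on k S (\<lambda>x. f x / g x)"
  using Ck_on_mult[OF assms(1) Ck_on_inverse[OF assms(2,3)]] by (simp add: field_simps)

lemma Ck_on_sqrt: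
  assumes "Ck_on k S f" "\<And>x. x \<in> S \<Longrightarrow> f x > 0"
  shows "Ck_on k S (\<lambda>x. sqrt (f x))"
  using assms(1)
proof (induction k)
  case 0
  then show ?case by (simp add: continuous_on_real_sqrt)
next
  case (Suc k)
  obtain f1 f2 where f: "\<forall>x\<in>S. (f has_derivative (\<lambda>h. fst h * f1 x + snd h * f2 x)) (at x)"
    "Ck_on k S f1" "Ck_on k S f2" using Suc.prems(1) by (rule Ck_on_SucE)
  note fd = f(1)[rule_format]
  have i: "Ck_on k S (\<lambda>x. sqrt (f x))" using Suc.IH Ck_on_Suc_imp Suc.prems by blast
  have nz: "x \<in> S \<Longrightarrow> sqrt (f x) \<noteq> 0" for x using assms(2)[of x] by simp
  show ?case
  proof (rule Ck_on_SucI[where ?g1.0="\<lambda>x. f1 x / (2 * sqrt (f x))"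
          and ?g2.0="\<lambda>x. f2 x / (2 * sqrt (f x))"])
    fix x assume x: "x \<in> S"
    show "((\<lambda>x. sqrt (f x)) has_derivative (\<lambda>h. fst h * (f1 x / (2 * sqrt (f x)))
        + snd h * (f2 x / (2 * sqrt (f x))))) (at x)"
      by (rule has_derivative_eq_rhs[OF has_derivative_real_sqrt[OF assms(2) fd, OF x x]])
        (use nz[OF x] in \<open>simp add: fun_eq_iff field_simps\<close>)
  qed (rule Ck_on_divide Ck_on_mult Ck_on_const i f(2,3) | use nz in simp)+
qed

lemma Ck_on_compose:
  assumes "Ck_on k T g" "Ck_on k S (\<lambda>x. fst (f x))" "Ck_on k S (\<lambda>x. snd (f x))" "f ` S \<subseteq> T"
  shows "Ck_on k S (\<lambda>x. g (f x))"
  using assms(1-3)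
proof (induction k arbitrary: g)
  case 0
  have "continuous_on S (\<lambda>x. (fst (f x), snd (f x)))"
    by (rule continuous_on_Pair) (use 0 in auto)
  then have "continuous_on S f" by simp
  then show ?case using 0 assms(4) by (simp add: continuous_on_compose2[of T g])
next
  case (Suc k)
  obtain g1 g2 where g: "\<forall>x\<in>T. (g has_derivative (\<lambda>h. fst h * g1 x + snd h * g2 x)) (at x)"
    "Ck_on k T g1" "Ck_on k T g2" using Suc.prems(1) by (rule Ck_on_SucE)
  note gd = g(1)[rule_format]
  obtain a1 a2 where a: "\<forall>x\<in>S. ((\<lambda>x. fst (f x)) has_derivative (\<lambda>h. fst h * a1 x + snd h * a2 x)) (at x)"
    "Ck_on k S a1" "Ck_on k S a2" using Suc.prems(2) by (rule Ck_on_SucE)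
  note ad = a(1)[rule_format]
  obtain b1 b2 where b: "\<forall>x\<in>S. ((\<lambda>x. snd (f x)) has_derivative (\<lambda>h. fst h * b1 x + snd h * b2 x)) (at x)"
    "Ck_on k S b1" "Ck_on k S b2" using Suc.prems(3) by (rule Ck_on_SucE)
  note bd = b(1)[rule_format]
  have c: "Ck_on k S (\<lambda>x. g1 (f x))" "Ck_on k S (\<lambda>x. g2 (f x))"
    using Suc.IH[of g1] Suc.IH[of g2] g(2,3) Suc.prems(2,3) Ck_on_Suc_imp by blast+
  show ?case
  proof (rule Ck_on_SucI[where ?g1.0="\<lambda>x. g1 (f x) * a1 x + g2 (f x) * b1 x"
          and ?g2.0="\<lambda>x. g1 (f x) * a2 x + g2 (f x) * b2 x"])
    fix x assume x: "x \<in> S"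
    have "((\<lambda>x. (fst (f x), snd (f x))) has_derivative
        (\<lambda>h. (fst h * a1 x + snd h * a2 x, fst h * b1 x + snd h * b2 x))) (at x)"
      by (rule has_derivative_Pair[OF ad[OF x] bd[OF x]])
    then have "(f has_derivative
        (\<lambda>h. (fst h * a1 x + snd h * a2 x, fst h * b1 x + snd h * b2 x))) (at x)" by simp
    from has_derivative_compose[OF this gd[of "f x"]] x assms(4)
    show "((\<lambda>x. g (f x)) has_derivative (\<lambda>h. fst h * (g1 (f x) * a1 x + g2 (f x) * b1 x)
        + snd h * (g1 (f x) * a2 x + g2 (f x) * b2 x))) (at x)"
      by (simp add: algebra_simps image_subset_iff)
  qed (intro Ck_on_add Ck_on_mult a(2,3) b(2,3) c)+
qed

text \<open>For each order \<open>Ck_on\<close> asserts the existence of some partial derivatives.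
  Uniqueness of the derivative identifies them with the given pair, which thereby inherits every
  order.\<close>

lemma Ck_on_partial:
  assumes "open S" and "\<And>k. Ck_on k S f"
    and d: "\<And>x. x \<in> S \<Longrightarrow> (f has_derivative (\<lambda>h. fst h * f1 x + snd h * f2 x)) (at x)"
  shows "Ck_on k S f1" "Ck_on k S f2"
proof -
  obtain g1 g2 where g: "\<forall>x\<in>S. (f has_derivative (\<lambda>h. fst h * g1 x + snd h * g2 x)) (at x)"
    "Ck_on k S g1" "Ck_on k S g2" using assms(2)[of "Suc k"] by (rule Ck_on_SucE)
  note gd = g(1)[rule_format]
  have *: "g1 x = f1 x \<and> g2 x = f2 x" if "x \<in> S" for x
  proof -
    have e: "(\<lambda>h. fst h * g1 x + snd h * g2 x) = (\<lambda>h. fst h * f1 x + snd h * f2 x)"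
      using has_derivative_unique[OF gd[OF that] d[OF that]] .
    show ?thesis using fun_cong[OF e, of "(1,0)"] fun_cong[OF e, of "(0,1)"] by simp
  qed
  show "Ck_on k S f1" "Ck_on k S f2"
    using Ck_on_cong[OF assms(1) _ g(2), of f1] Ck_on_cong[OF assms(1) _ g(3), of f2] * by auto
qed

text \<open>The derivative of the inverse is Cramer's rule. Injectivity and continuity of
  \<open>f\<close> on an open set suffice; continuity of the inverse is a result and not an
  assumption.\<close>

lemma has_derivative_inverse_plane:
  fixes f :: "real \<times> real \<Rightarrow> real \<times> real"
  assumes "open S" "x \<in> S" "inj_on f S" "continuous_on S f"
    and d1: "((\<lambda>x. fst (f x)) has_derivative (\<lambda>h. fst h * a + snd h * b)) (at x)"
    and d2: "((\<lambda>x. snd (f x)) has_derivative (\<lambda>h. fst h * c + snd h * d)) (at x)"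
    and det: "a * d - b * c \<noteq> 0"
  shows "(inv_into S f has_derivative (\<lambda>h. ((fst h * d - snd h * b) / (a * d - b * c),
    (snd h * a - fst h * c) / (a * d - b * c)))) (at (f x))"
proof (rule has_derivative_inverse_strong[OF assms(1,2,4)])
  show "inv_into S f (f y) = y" if "y \<in> S" for y using assms(3) that by simp
  have "((\<lambda>x. (fst (f x), snd (f x))) has_derivative
        (\<lambda>h. (fst h * a + snd h * b, fst h * c + snd h * d))) (at x)"
    by (rule has_derivative_Pair[OF d1 d2])
  then show "(f has_derivative (\<lambda>h. (fst h * a + snd h * b, fst h * c + snd h * d))) (at x)" by simp
  have "((p * d - q * b) * a + (q * a - p * c) * b) / (a * d - b * c) = p"
       "((p * d - q * b) * c + (q * a - p * c) * d) / (a * d - b * c) = q" for p q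
    using det by (simp_all add: divide_eq_eq algebra_simps)
  then show "(\<lambda>h. (fst h * a + snd h * b, fst h * c + snd h * d)) \<circ>
    (\<lambda>h. ((fst h * d - snd h * b) / (a * d - b * c), (snd h * a - fst h * c) / (a * d - b * c))) = id"
    by (auto simp: fun_eq_iff add_divide_distrib)
qed

lemma smooth_on_imp_continuous_on: "smooth_on S f \<Longrightarrow> continuous_on S f"
proof -
  assume "smooth_on S f"
  then have "Ck_on 0 S (\<lambda>x. fst (f x))" "Ck_on 0 S (\<lambda>x. snd (f x))"
    unfolding smooth_on_def by blast+
  then have "continuous_on S (\<lambda>x. (fst (f x), snd (f x)))"
    by (intro continuous_on_Pair) auto
  then show ?thesis by simp
qed

text \<open>Smoothness of the inverse \<open>g\<close> is a bootstrap: its partial derivatives are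
  quotients of \<open>a\<close>, \<open>b\<close>, \<open>c\<close>, \<open>d\<close> evaluated at
  \<open>g y\<close>, so if \<open>g\<close> is C^k, they are too, and \<open>g\<close> is
  C^(k+1).\<close>

lemma diffeomorphism_on_if_jacobian_nonzero:
  fixes f :: "real \<times> real \<Rightarrow> real \<times> real"
  assumes "open S" "inj_on f S" "f ` S = T" "smooth_on S f"
    and d1: "\<And>x. x \<in> S \<Longrightarrow> ((\<lambda>x. fst (f x)) has_derivative (\<lambda>h. fst h * a x + snd h * b x)) (at x)"
    and d2: "\<And>x. x \<in> S \<Longrightarrow> ((\<lambda>x. snd (f x)) has_derivative (\<lambda>h. fst h * c x + snd h * d x)) (at x)"
    and det: "\<And>x. x \<in> S \<Longrightarrow> a x * d x - b x * c x \<noteq> 0"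
  shows "diffeomorphism_on S T f"
proof -
  define g where "g = inv_into S f"
  define dt where "dt = (\<lambda>x. a x * d x - b x * c x)"
  have ck: "Ck_on k S (\<lambda>x. fst (f x))" "Ck_on k S (\<lambda>x. snd (f x))" for k
    using assms(4) unfolding smooth_on_def by blast+
  have cf: "continuous_on S f" by (rule smooth_on_imp_continuous_on[OF assms(4)])
  have p: "Ck_on k S a" "Ck_on k S b" "Ck_on k S c" "Ck_on k S d" for k
    using Ck_on_partial[OF assms(1) ck(1) d1] Ck_on_partial[OF assms(1) ck(2) d2] by auto
  have gS: "g y \<in> S" "f (g y) = y" if "y \<in> T" for y
    using that assms(3) unfolding g_def by (auto simp: inv_into_into f_inv_into_f)
  have D: "(g has_derivative (\<lambda>h. ((fst h * d (g y) - snd h * b (g y)) / dt (g y),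
    (snd h * a (g y) - fst h * c (g y)) / dt (g y)))) (at y)" if "y \<in> T" for y
    using has_derivative_inverse_plane[OF assms(1) gS(1)[OF that] assms(2) cf d1 d2 det] gS[OF that]
    unfolding g_def dt_def by simp
  have "Ck_on k T (\<lambda>y. fst (g y)) \<and> Ck_on k T (\<lambda>y. snd (g y))" for k
  proof (induction k)
    case 0
    have "continuous_on T g"
      using D by (blast intro: continuous_at_imp_continuous_on has_derivative_continuous)
    then show ?case by (simp add: continuous_on_fst continuous_on_snd)
  next
    case (Suc k)
    have im: "g ` T \<subseteq> S" using gS by auto
    have q: "Ck_on k T (\<lambda>y. \<phi> (g y))" if "Ck_on k S \<phi>" for \<phi>
      using Ck_on_compose[OF that _ _ im] Suc by auto
    have dtk: "Ck_on k S dt" unfolding dt_def by (intro Ck_on_diff Ck_on_mult p)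
    have nz: "y \<in> T \<Longrightarrow> dt (g y) \<noteq> 0" for y using det gS(1) unfolding dt_def by blast
    have "Ck_on (Suc k) T (\<lambda>y. fst (g y))"
    proof (rule Ck_on_SucI[where ?g1.0="\<lambda>y. d (g y) / dt (g y)" and ?g2.0="\<lambda>y. - (b (g y) / dt (g y))"])
      show "((\<lambda>y. fst (g y)) has_derivative (\<lambda>h. fst h * (d (g y) / dt (g y)) + snd h * (- (b (g y) / dt (g y))))) (at y)"
        if "y \<in> T" for y
        using has_derivative_fst[OF D[OF that]] by (simp add: diff_divide_distrib)
    qed (intro Ck_on_minus Ck_on_divide q dtk p nz; assumption)+
    moreover have "Ck_on (Suc k) T (\<lambda>y. snd (g y))"
    proof (rule Ck_on_SucI[where ?g1.0="\<lambda>y. - (c (g y) / dt (g y))" and ?g2.0="\<lambda>y. a (g y) / dt (g y)"])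
      show "((\<lambda>y. snd (g y)) has_derivative (\<lambda>h. fst h * (- (c (g y) / dt (g y))) + snd h * (a (g y) / dt (g y)))) (at y)"
        if "y \<in> T" for y
        using has_derivative_snd[OF D[OF that]] by (simp add: diff_divide_distrib)
    qed (intro Ck_on_minus Ck_on_divide q dtk p nz; assumption)+
    ultimately show ?case ..
  qed
  then show ?thesis using assms(2-4) unfolding diffeomorphism_on_def smooth_on_def g_def by blast
qed

lemma smooth_on_compose:
  "smooth_on T g \<Longrightarrow> smooth_on S f \<Longrightarrow> f ` S \<subseteq> T \<Longrightarrow> smooth_on S (\<lambda>x. g (f x))"
  unfolding smooth_on_def by (auto intro: Ck_on_compose)

lemma smooth_on_cong:
  "open S \<Longrightarrow> (\<And>x. x \<in> S \<Longrightarrow> f x = g x) \<Longrightarrow> smooth_on S f \<Longrightarrow> smooth_on S g"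
  unfolding smooth_on_def
  by (auto intro: Ck_on_cong[of S "\<lambda>x. fst (f x)"] Ck_on_cong[of S "\<lambda>x. snd (f x)"])

text \<open>The explicit inverse \<open>g\<close> agrees with \<open>inv_into S f\<close> only on
  \<open>T\<close>; openness of \<open>T\<close> lets smoothness pass from one to the other.\<close>

lemma diffeomorphism_onI:
  assumes "open T" "f ` S \<subseteq> T" "g ` T \<subseteq> S"
    and gf: "\<And>x. x \<in> S \<Longrightarrow> g (f x) = x" and fg: "\<And>y. y \<in> T \<Longrightarrow> f (g y) = y"
    and "smooth_on S f" "smooth_on T g"
  shows "diffeomorphism_on S T f"
proof -
  have inj: "inj_on f S" by (rule inj_on_inverseI[where g=g]) (rule gf)
  have im: "f ` S = T"
  proof
    show "T \<subseteq> f ` S"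
    proof
      fix y assume "y \<in> T"
      then have "f (g y) = y" "g y \<in> S" using fg assms(3) by blast+
      then show "y \<in> f ` S" by (metis imageI)
    qed
  qed fact
  have "g y = inv_into S f y" if "y \<in> T" for y
    using inv_into_f_eq[OF inj, of "g y" y] that assms(3) fg by auto
  then have "smooth_on T (inv_into S f)"
    using smooth_on_cong[OF assms(1) _ assms(7)] by blast
  then show ?thesis using inj im assms(6) unfolding diffeomorphism_on_def by blast
qed

text \<open>On \<open>U\<close> the map \<open>g\<close> is \<open>f\<close> after the inverse of
  \<open>h\<close>. This undoes a change of coordinates \<open>h\<close> once the map is understood
  in the coordinates.\<close>

lemma diffeomorphism_on_compose_inverse:
  assumes "open U" "open T" "diffeomorphism_on S T f" "diffeomorphism_on S U h"
    and eq: "\<And>x. x \<in> S \<Longrightarrow> g (h x) = f x"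
  shows "diffeomorphism_on U T g"
proof -
  have f: "inj_on f S" "f ` S = T" "smooth_on S f" "smooth_on T (inv_into S f)"
   and h: "inj_on h S" "h ` S = U" "smooth_on S h" "smooth_on U (inv_into S h)"
    using assms(3,4) unfolding diffeomorphism_on_def by blast+
  have hi: "inv_into S h u \<in> S" "h (inv_into S h u) = u" if "u \<in> U" for u
    using that h(2) by (auto simp: inv_into_into f_inv_into_f)
  have fi: "inv_into S f u \<in> S" "f (inv_into S f u) = u" if "u \<in> T" for u
    using that f(2) by (auto simp: inv_into_into f_inv_into_f)
  have g: "g u = f (inv_into S h u)" if "u \<in> U" for u
    using eq[OF hi(1)[OF that]] hi(2)[OF that] by simp
  show ?thesis
  proof (rule diffeomorphism_onI[where g="\<lambda>y. h (inv_into S f y)"])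
    show "smooth_on U g"
      by (rule smooth_on_cong[OF assms(1) g[symmetric]], assumption,
          rule smooth_on_compose[OF f(3) h(4)]) (use hi in auto)
    show "smooth_on T (\<lambda>y. h (inv_into S f y))"
      by (rule smooth_on_compose[OF h(3) f(4)]) (use fi in auto)
    show "g ` U \<subseteq> T" using f hi g by force
    show "(\<lambda>y. h (inv_into S f y)) ` T \<subseteq> U" using h fi by force
    show "h (inv_into S f (g u)) = u" if "u \<in> U" for u
      using g[OF that] hi[OF that] f(1) by simp
    show "g (h (inv_into S f y)) = y" if "y \<in> T" for y
      using eq fi[OF that] by simp
  qed fact
qed

section \<open>Complete elliptic integrals\<close>

text \<open>Legendre's Delta in the parameter \<open>m = k^2\<close>. It is positive for all
  \<open>m < 1\<close>, negative \<open>m\<close> included, which makes \<open>m = 0\<close> an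
  interior point for K and E.\<close>

definition ell_delta :: "real \<Rightarrow> real \<Rightarrow> real" where
  "ell_delta m t = sqrt (1 - m * (sin t)^2)"

definition ellK :: "real \<Rightarrow> real" where
  "ellK m = integral {0..pi/2} (\<lambda>t. 1 / ell_delta m t)"

definition ellE :: "real \<Rightarrow> real" where
  "ellE m = integral {0..pi/2} (\<lambda>t. ell_delta m t)"

lemma ell_radicand_pos:
  fixes m t :: real
  assumes m: "m < 1"
  shows "0 < 1 - m * (sin t)^2"
proof -
  show ?thesis
  proof (cases "m \<le> 0")
    case True
    then have "m * (sin t)^2 \<le> 0" by (intro mult_nonpos_nonneg) auto
    then show ?thesis by simp
  next
    case False
    have "(sin t)^2 \<le> 1" by (simp add: abs_square_le_1)
    then have "m * (sin t)^2 \<le> m * 1" using False by (intro mult_left_mono) auto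
    then show ?thesis using m by simp
  qed
qed

lemma ell_delta_pos: "m < 1 \<Longrightarrow> 0 < ell_delta m t"
  unfolding ell_delta_def using ell_radicand_pos[of m t] by simp

lemma ell_delta_sq: "m < 1 \<Longrightarrow> (ell_delta m t)^2 = 1 - m * (sin t)^2"
  unfolding ell_delta_def using ell_radicand_pos[of m t] by simp

lemma continuous_on_ell_delta: "continuous_on A (ell_delta m)"
  unfolding ell_delta_def by (intro continuous_intros)

lemma ell_integrable:
  assumes "m < 1"
  shows "(\<lambda>t. 1 / ell_delta m t) integrable_on {a..b}" "ell_delta m integrable_on {a..b}"
    "(\<lambda>t. (sin t)^2 / ell_delta m t) integrable_on {a..b}"
    "(\<lambda>t. 1 / (ell_delta m t)^3) integrable_on {a..b}"
  using ell_delta_pos[OF assms, THEN less_imp_neq]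
  by (intro integrable_continuous_real continuous_intros continuous_on_ell_delta; force)+

lemma continuous_on_ell_delta2:
  "continuous_on ({..<1} \<times> {0..pi/2}) (\<lambda>x. ell_delta (fst x) (snd x))"
  unfolding ell_delta_def by (intro continuous_intros)

lemma ell_delta_has_derivative_parameter:
  assumes "m < 1"
  shows "((\<lambda>m. ell_delta m t) has_field_derivative - ((sin t)^2 / (2 * ell_delta m t))) (at m within U)"
  unfolding ell_delta_def using ell_radicand_pos[OF assms, of t]
  by (auto intro!: derivative_eq_intros simp: field_simps)

text \<open>The derivative stays an integral here because this form is valid at \<open>m = 0\<close>
  too, where continuity is needed later.\<close>

lemma ellE_has_derivative_integral:
  assumes "m < 1"
  shows "(ellE has_field_derivative integral {0..pi/2} (\<lambda>t. - ((sin t)^2 / (2 * ell_delta m t)))) (at m)"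
proof -
  have "((\<lambda>m. integral (cbox 0 (pi/2)) (ell_delta m)) has_field_derivative
      integral (cbox 0 (pi/2)) (\<lambda>t. - ((sin t)^2 / (2 * ell_delta m t)))) (at m within {..<1})"
  proof (rule leibniz_rule_field_derivative)
    have "continuous_on ({..<1} \<times> {0..pi/2}) (\<lambda>x. - ((sin (snd x))^2 / (2 * ell_delta (fst x) (snd x))))"
      by (intro continuous_intros continuous_on_ell_delta2)
        (use ell_delta_pos[THEN less_imp_neq] in force)
    then show "continuous_on ({..<1} \<times> cbox 0 (pi/2)) (\<lambda>(m, t). - ((sin t)^2 / (2 * ell_delta m t)))"
      by (simp add: case_prod_unfold)
  qed (use assms ell_integrable ell_delta_has_derivative_parameter in auto)
  then show ?thesis using assms unfolding ellE_def by (simp add: at_within_open[of m "{..<1}"])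
qed

lemma ellK_has_derivative_integral:
  assumes "m < 1"
  shows "(ellK has_field_derivative integral {0..pi/2} (\<lambda>t. (sin t)^2 / (2 * (ell_delta m t)^3))) (at m)"
proof -
  have "((\<lambda>m. integral (cbox 0 (pi/2)) (\<lambda>t. 1 / ell_delta m t)) has_field_derivative
      integral (cbox 0 (pi/2)) (\<lambda>t. (sin t)^2 / (2 * (ell_delta m t)^3))) (at m within {..<1})"
  proof (rule leibniz_rule_field_derivative)
    have "continuous_on ({..<1} \<times> {0..pi/2}) (\<lambda>x. (sin (snd x))^2 / (2 * (ell_delta (fst x) (snd x))^3))"
      by (intro continuous_intros continuous_on_ell_delta2)
        (use ell_delta_pos[THEN less_imp_neq] in force)
    then show "continuous_on ({..<1} \<times> cbox 0 (pi/2)) (\<lambda>(m, t). (sin t)^2 / (2 * (ell_delta m t)^3))"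
      by (simp add: case_prod_unfold)
    fix x t :: real assume "x \<in> {..<1}"
    then have "x < 1" by simp
    from ell_delta_pos[OF this, of t]
    show "((\<lambda>m. 1 / ell_delta m t) has_field_derivative (sin t)^2 / (2 * (ell_delta x t)^3)) (at x within {..<1})"
      by (auto intro!: derivative_eq_intros ell_delta_has_derivative_parameter \<open>x < 1\<close> simp: field_simps power3_eq_cube)
  qed (use assms ell_integrable in auto)
  then show ?thesis using assms unfolding ellK_def by (simp add: at_within_open[of m "{..<1}"])
qed

lemma ell_sin_sq_integral:
  assumes "m < 1"
  shows "m * integral {0..pi/2} (\<lambda>t. (sin t)^2 / ell_delta m t) = ellK m - ellE m"
proof -
  have "m * ((sin t)^2 / ell_delta m t) = 1 / ell_delta m t - ell_delta m t" for t
    using ell_delta_pos[OF assms, of t] ell_delta_sq[OF assms, of t]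
    by (simp add: field_simps power2_eq_square)
  then have "integral {0..pi/2} (\<lambda>t. m * ((sin t)^2 / ell_delta m t)) =
      integral {0..pi/2} (\<lambda>t. 1 / ell_delta m t - ell_delta m t)" by simp
  then show ?thesis unfolding ellK_def ellE_def
    by (simp only: integral_mult_right integral_diff[OF ell_integrable(1,2)[OF assms]])
qed

lemma ellE_has_derivative:
  assumes "m < 1" "m \<noteq> 0"
  shows "(ellE has_field_derivative (ellE m - ellK m) / (2 * m)) (at m)"
proof -
  have "integral {0..pi/2} (\<lambda>t. - ((sin t)^2 / (2 * ell_delta m t)))
      = integral {0..pi/2} (\<lambda>t. (-1/2) * ((sin t)^2 / ell_delta m t))"
    by (rule integral_cong) simp
  also have "\<dots> = (-1/2) * integral {0..pi/2} (\<lambda>t. (sin t)^2 / ell_delta m t)"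
    by (rule integral_mult_right)
  also have "\<dots> = (ellE m - ellK m) / (2 * m)"
    using ell_sin_sq_integral[OF assms(1)] assms(2) by (simp add: field_simps)
  finally show ?thesis using ellE_has_derivative_integral[OF assms(1)] by simp
qed

text \<open>The function \<open>m sin t cos t / ell_delta m t\<close> vanishes at both ends and has
  derivative \<open>ell_delta - (1 - m) / ell_delta^3\<close>. This is what expresses the derivative
  of K by K and E again.\<close>

lemma ell_delta_inverse_cube_integral:
  assumes "m < 1"
  shows "(1 - m) * integral {0..pi/2} (\<lambda>t. 1 / (ell_delta m t)^3) = ellE m"
proof -
  have D: "((\<lambda>t. m * sin t * cos t / ell_delta m t) has_vector_derivative
      ell_delta m t - (1 - m) * (1 / (ell_delta m t)^3)) (at t within {0..pi/2})" for t
  proof -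
    define d where "d = ell_delta m t"
    have d: "d > 0" "d^2 = 1 - m * (sin t)^2"
      using ell_delta_pos[OF assms, of t] ell_delta_sq[OF assms, of t] unfolding d_def by auto
    then have d3: "d^2 = 1 - m + m * (cos t)^2" by (simp add: sin_squared_eq algebra_simps)
    have "(ell_delta m has_field_derivative - (m * sin t * cos t / d)) (at t within {0..pi/2})"
      unfolding ell_delta_def d_def using ell_radicand_pos[OF assms, of t]
      by (auto intro!: derivative_eq_intros simp: field_simps)
    then have "((\<lambda>t. m * sin t * cos t / ell_delta m t) has_field_derivative
      ((m * cos t * cos t - m * sin t * sin t) * d + m * sin t * cos t * (m * sin t * cos t / d)) / (d * d)) (at t within {0..pi/2})"
      using d(1) by (auto intro!: derivative_eq_intros simp: d_def algebra_simps)
    moreover have "((m * cos t * cos t - m * sin t * sin t) * d + m * sin t * cos t * (m * sin t * cos t / d)) / (d * d)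
        = d - (1 - m) * (1 / d^3)"
    proof -
      have mc: "m * (cos t)^2 = d^2 - 1 + m" and ms: "m * (sin t)^2 = 1 - d^2" using d d3 by auto
      have "(m * cos t * cos t - m * sin t * sin t) * d + m * sin t * cos t * (m * sin t * cos t / d)
         = (m * (cos t)^2 - m * (sin t)^2) * d + (m * (sin t)^2) * (m * (cos t)^2) / d"
        by (simp add: power2_eq_square algebra_simps)
      also have "\<dots> = ((d^2 - 1 + m) - (1 - d^2)) * d + (1 - d^2) * (d^2 - 1 + m) / d"
        unfolding mc ms ..
      also have "\<dots> / (d * d) = d - (1 - m) * (1 / d^3)"
        using d(1) by (simp add: field_simps power2_eq_square power3_eq_cube)
      finally show ?thesis .
    qed
    ultimately show ?thesis
      by (simp add: d_def has_real_derivative_iff_has_vector_derivative)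
  qed
  have "((\<lambda>t. ell_delta m t - (1 - m) * (1 / (ell_delta m t)^3)) has_integral
      (m * sin (pi/2) * cos (pi/2) / ell_delta m (pi/2) - m * sin 0 * cos 0 / ell_delta m 0)) {0..pi/2}"
    by (rule fundamental_theorem_of_calculus) (use D in auto)
  then have "integral {0..pi/2} (\<lambda>t. ell_delta m t - (1 - m) * (1 / (ell_delta m t)^3)) = 0"
    by (simp add: integral_unique)
  moreover have "integral {0..pi/2} (\<lambda>t. ell_delta m t - (1 - m) * (1 / (ell_delta m t)^3)) =
     ellE m - (1 - m) * integral {0..pi/2} (\<lambda>t. 1 / (ell_delta m t)^3)"
    unfolding ellE_def using ell_integrable[OF assms]
    by (subst integral_diff) (auto intro: integrable_on_mult_right simp only: integral_mult_right)
  ultimately show ?thesis by simp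
qed

lemma ellK_has_derivative:
  assumes "m < 1" "m \<noteq> 0"
  shows "(ellK has_field_derivative (ellE m - (1 - m) * ellK m) / (2 * m * (1 - m))) (at m)"
proof -
  define I where "I = integral {0..pi/2} (\<lambda>t. 1 / (ell_delta m t)^3)"
  have "(sin t)^2 / (2 * (ell_delta m t)^3) = 1 / (2 * m) * (1 / (ell_delta m t)^3 - 1 / ell_delta m t)" for t
    using ell_delta_pos[OF assms(1), of t] ell_delta_sq[OF assms(1), of t] assms(2)
    by (simp add: field_simps power2_eq_square power3_eq_cube)
  then have "integral {0..pi/2} (\<lambda>t. (sin t)^2 / (2 * (ell_delta m t)^3))
      = integral {0..pi/2} (\<lambda>t. 1 / (2 * m) * (1 / (ell_delta m t)^3 - 1 / ell_delta m t))"
    by presburger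
  also have "\<dots> = 1 / (2 * m) * (I - ellK m)"
    unfolding I_def ellK_def
    by (simp only: integral_mult_right integral_diff[OF ell_integrable(4,1)[OF assms(1)]])
  also have "\<dots> = (ellE m - (1 - m) * ellK m) / (2 * m * (1 - m))"
  proof -
    have I: "ellE m = (1 - m) * I"
      using ell_delta_inverse_cube_integral[OF assms(1)] unfolding I_def by simp
    show ?thesis unfolding I using assms by (simp add: field_simps)
  qed
  finally show ?thesis using ellK_has_derivative_integral[OF assms(1)] by simp
qed

section \<open>Inequalities between K and E\<close>

lemma ellE_ge: assumes "m < 1" "0 \<le> m" shows "(1 - m) * ellK m \<le> ellE m"
proof -
  have "(1 - m) * (1 / ell_delta m t) \<le> ell_delta m t" for t
  proof -
    have "(sin t)^2 \<le> 1" by (simp add: abs_square_le_1)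
    then have "m * (sin t)^2 \<le> m * 1" using assms(2) by (intro mult_left_mono) auto
    then have "1 - m \<le> ell_delta m t * ell_delta m t"
      using ell_delta_sq[OF assms(1), of t] by (simp add: power2_eq_square)
    then show ?thesis using ell_delta_pos[OF assms(1), of t] by (simp add: field_simps)
  qed
  then have "integral {0..pi/2} (\<lambda>t. (1 - m) * (1 / ell_delta m t)) \<le> integral {0..pi/2} (ell_delta m)"
    using ell_integrable[OF assms(1)] by (intro integral_le) (auto intro: integrable_on_mult_right simp del: times_divide_eq_right)
  then show ?thesis unfolding ellE_def ellK_def by (simp only: integral_mult_right)
qed

lemma ellE_ge_1: assumes "m < 1" shows "1 \<le> ellE m"
proof -
  have "((\<lambda>t. cos t) has_integral (sin (pi/2) - sin 0)) {0..pi/2}"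
    by (rule fundamental_theorem_of_calculus)
      (auto intro!: derivative_eq_intros simp: has_real_derivative_iff_has_vector_derivative[symmetric])
  then have c: "((\<lambda>t. cos t) has_integral 1) {0..pi/2}" by simp
  have "cos t \<le> ell_delta m t" for t
  proof -
    have "(sin t)^2 * m \<le> (sin t)^2 * 1" using assms by (intro mult_left_mono) auto
    then have "(cos t)^2 \<le> 1 - m * (sin t)^2" by (simp add: cos_squared_eq mult.commute)
    then show ?thesis unfolding ell_delta_def by (rule real_le_rsqrt)
  qed
  then show ?thesis unfolding ellE_def
    by (intro has_integral_le[OF c integrable_integral[OF ell_integrable(2)[OF assms]]])
qed

text \<open>The weight \<open>cos 2t\<close> has mean zero and is nonnegative exactly where the increasing function
  \<open>1 / ell_delta m\<close> lies below its value at \<open>pi/4\<close>.\<close>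

lemma ellE_le: assumes "m < 1" "0 \<le> m" shows "ellE m \<le> (1 - m/2) * ellK m"
proof -
  define c where "c = 1 / sqrt (1 - m/2)"
  have s0: "((\<lambda>t. c * cos (2 * t)) has_integral 0) {0..pi/2}"
  proof -
    have "((\<lambda>t. c * cos (2 * t)) has_integral (c * sin (2 * (pi/2)) / 2 - c * sin (2 * 0) / 2)) {0..pi/2}"
      by (rule fundamental_theorem_of_calculus)
        (auto intro!: derivative_eq_intros simp: has_real_derivative_iff_has_vector_derivative[symmetric])
    then show ?thesis by simp
  qed
  have i1: "((\<lambda>t. ell_delta m t - (1 - m/2) * (1 / ell_delta m t)) has_integral (ellE m - (1 - m/2) * ellK m)) {0..pi/2}"
    unfolding ellE_def ellK_def using ell_integrable[OF assms(1)]
    by (intro has_integral_diff has_integral_mult_right integrable_integral)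
  have i2: "((\<lambda>t. m/2 * (c * cos (2 * t))) has_integral (m/2 * 0)) {0..pi/2}"
    by (intro has_integral_mult_right s0)
  have "ell_delta m t - (1 - m/2) * (1 / ell_delta m t) \<le> m/2 * (c * cos (2 * t))" for t
  proof -
    define d where "d = ell_delta m t"
    define e where "e = sqrt (1 - m/2)"
    have d: "d > 0" "d^2 = 1 - m * (sin t)^2" and e: "e > 0" "e^2 = 1 - m/2"
      using ell_delta_pos[OF assms(1), of t] ell_delta_sq[OF assms(1), of t] assms
      unfolding d_def e_def by auto
    have k: "m/2 * cos (2 * t) = d^2 - e^2"
      unfolding d(2) e(2) cos_double_sin by (simp add: algebra_simps)
    \<comment> \<open>The left side of the goal is \<open>(d^2 - e^2) / d\<close>. Replacing
      \<open>1 / d\<close> by the constant \<open>1 / e\<close> can only increase it, since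
      \<open>1 / d - 1 / e\<close> and \<open>d^2 - e^2\<close> have opposite signs; after
      multiplication by \<open>d e\<close> the gain is this product.\<close>
    have "0 \<le> (d - e)^2 * (d + e)" using d e by simp
    then have "d - e^2 * (1 / d) \<le> (d^2 - e^2) * (1 / e)"
      using d(1) e(1) by (simp add: field_simps power2_eq_square)
    also have "\<dots> = m/2 * (c * cos (2 * t))" unfolding c_def e_def[symmetric] k[symmetric] by simp
    finally show ?thesis unfolding d_def[symmetric] e(2)[symmetric] .
  qed
  then have "ellE m - (1 - m/2) * ellK m \<le> m/2 * 0"
    by (intro has_integral_le[OF i1 i2])
  then show ?thesis by simp
qed

lemma ellE_le_ellK: assumes "m < 1" "0 \<le> m" shows "ellE m \<le> ellK m"
proof -
  have "0 \<le> integral {0..pi/2} (\<lambda>t. (sin t)^2 / ell_delta m t)"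
    by (intro integral_nonneg ell_integrable assms) (simp add: ell_delta_pos[OF assms(1)] less_imp_le)
  then show ?thesis using ell_sin_sq_integral[OF assms(1)] assms by (smt (verit) mult_nonneg_nonneg)
qed

lemma ellK_ge_1: "m < 1 \<Longrightarrow> 0 \<le> m \<Longrightarrow> 1 \<le> ellK m"
  using ellE_le_ellK ellE_ge_1 by force

lemma ellK_0: "ellK 0 = pi / 2" and ellE_0: "ellE 0 = pi / 2"
  by (simp_all add: ellK_def ellE_def ell_delta_def)

lemma continuous_ellK: "m < 1 \<Longrightarrow> isCont ellK m" and continuous_ellE: "m < 1 \<Longrightarrow> isCont ellE m"
  using ellK_has_derivative_integral ellE_has_derivative_integral DERIV_isCont by blast+

lemma ellK_mono:
  assumes "0 \<le> m" "m \<le> n" "n < 1" shows "ellK m \<le> ellK n"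
proof (rule DERIV_nonneg_imp_nondecreasing[OF assms(2)])
  fix x assume x: "m \<le> x" "x \<le> n"
  \<comment> \<open>The case split spares a proof of integrability: a function that is not
    integrable has integral 0 by default, which is nonnegative as well.\<close>
  then have "0 \<le> integral {0..pi/2} (\<lambda>t. (sin t)^2 / (2 * (ell_delta x t)^3))"
    using assms ell_delta_pos[of x]
    by (cases "(\<lambda>t. (sin t)^2 / (2 * (ell_delta x t)^3)) integrable_on {0..pi/2}")
      (auto intro!: integral_nonneg simp: less_imp_le not_integrable_integral)
  then show "\<exists>y. (ellK has_real_derivative y) (at x) \<and> 0 \<le> y"
    using ellK_has_derivative_integral[of x] x assms by auto
qed

text \<open>Since \<open>(K - E)' = E / (2 (1 - m)) \<ge> 1 / (2 (1 - m))\<close>, the difference grows at least logarithmically.\<close>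

lemma ellK_minus_ellE_ge:
  assumes "0 \<le> m" "m < 1" shows "- ln (1 - m) / 2 \<le> ellK m - ellE m"
proof -
  define g where "g = (\<lambda>m. ellK m - ellE m + ln (1 - m) / 2)"
  \<comment> \<open>Only the open interval is differentiated, because the closed formulas divide by
    the argument; the end 0 enters by continuity.\<close>
  have "g 0 \<le> g m"
  proof (rule DERIV_nonneg_imp_increasing_open[OF assms(1)])
    fix x assume x: "0 < x" "x < m"
    have "(g has_real_derivative (ellE x - (1 - x) * ellK x) / (2 * x * (1 - x)) - (ellE x - ellK x) / (2 * x) + - 1 / (1 - x) / 2) (at x)"
      unfolding g_def
    proof (intro DERIV_add DERIV_diff)
      show "((\<lambda>m. ln (1 - m) / 2) has_real_derivative - 1 / (1 - x) / 2) (at x)"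
        using x assms by (auto intro!: derivative_eq_intros simp: divide_simps)
    qed (use x assms in \<open>auto intro!: ellK_has_derivative ellE_has_derivative\<close>)
    moreover have "(ellE x - (1 - x) * ellK x) / (2 * x * (1 - x)) - (ellE x - ellK x) / (2 * x) + - 1 / (1 - x) / 2
        = (ellE x - 1) / (2 * (1 - x))"
    proof -
      have "1 - x \<noteq> 0" "x \<noteq> 0" using x assms by auto
      then show ?thesis by (simp add: divide_simps) (simp add: algebra_simps)
    qed
    moreover have "0 \<le> (ellE x - 1) / (2 * (1 - x))" using ellE_ge_1[of x] x assms by simp
    ultimately show "\<exists>y. (g has_real_derivative y) (at x) \<and> 0 \<le> y" by metis
  next
    show "continuous_on {0..m} g"
      unfolding g_def using assms
      by (auto intro!: continuous_at_imp_continuous_on continuous_intros continuous_ellK continuous_ellE)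
  qed
  then show ?thesis by (simp add: g_def ellK_0 ellE_0)
qed

text \<open>K and E are treated in one induction because the derivative of each is a rational
  expression in both.\<close>

lemma Ck_on_ellK_ellE:
  assumes f: "\<And>k. Ck_on k S f" and "\<And>x. x \<in> S \<Longrightarrow> 0 < f x \<and> f x < 1"
  shows "Ck_on k S (\<lambda>x. ellK (f x)) \<and> Ck_on k S (\<lambda>x. ellE (f x))"
proof (induction k)
  case 0
  have "continuous_on S f" using f[of 0] by simp
  moreover have "continuous_on {0<..<1} ellK" "continuous_on {0<..<1} ellE"
    by (auto intro!: continuous_at_imp_continuous_on continuous_ellK continuous_ellE)
  ultimately show ?case using assms(2)
    by (auto intro: continuous_on_compose2)
next
  case (Suc k)
  obtain f1 f2 where f': "\<forall>x\<in>S. (f has_derivative (\<lambda>h. fst h * f1 x + snd h * f2 x)) (at x)"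
    "Ck_on k S f1" "Ck_on k S f2" using f[of "Suc k"] by (rule Ck_on_SucE)
  note fd = f'(1)[rule_format]
  have chain: "((\<lambda>x. g (f x)) has_derivative (\<lambda>h. fst h * (d * f1 x) + snd h * (d * f2 x))) (at x)"
    if "(g has_field_derivative d) (at (f x))" "x \<in> S" for g d x
    using has_derivative_compose[OF fd[OF that(2)] that(1)[unfolded has_field_derivative_def]]
    by (simp add: algebra_simps)
  let ?K = "\<lambda>x. (ellE (f x) - (1 - f x) * ellK (f x)) / (2 * f x * (1 - f x))"
  let ?E = "\<lambda>x. (ellE (f x) - ellK (f x)) / (2 * f x)"
  have IH: "Ck_on k S (\<lambda>x. ellK (f x))" "Ck_on k S (\<lambda>x. ellE (f x))" using Suc by blast+
  have nz: "x \<in> S \<Longrightarrow> f x \<noteq> 0 \<and> f x \<noteq> 1" for x using assms(2)[of x] by auto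
  have K: "Ck_on k S ?K" and E: "Ck_on k S ?E"
    by (rule Ck_on_divide Ck_on_mult Ck_on_const Ck_on_diff f IH | use nz in force)+
  have "Ck_on (Suc k) S (\<lambda>x. ellK (f x))"
    by (rule Ck_on_SucI[where ?g1.0="\<lambda>x. ?K x * f1 x" and ?g2.0="\<lambda>x. ?K x * f2 x"])
      (use assms(2) nz in \<open>blast intro!: chain ellK_has_derivative\<close>,
       rule Ck_on_mult[OF K f'(2)], rule Ck_on_mult[OF K f'(3)])
  moreover have "Ck_on (Suc k) S (\<lambda>x. ellE (f x))"
    by (rule Ck_on_SucI[where ?g1.0="\<lambda>x. ?E x * f1 x" and ?g2.0="\<lambda>x. ?E x * f2 x"])
      (use assms(2) nz in \<open>blast intro!: chain ellE_has_derivative\<close>,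
       rule Ck_on_mult[OF E f'(2)], rule Ck_on_mult[OF E f'(3)])
  ultimately show ?case ..
qed

section \<open>Mass and momentum in elliptic coordinates\<close>

text \<open>The mass at the roots \<open>A w\<close>, \<open>A (w + m)\<close>,
  \<open>A (w + 1)\<close>. Sum 2 forces \<open>A = 2 / (3 w + 1 + m)\<close>, which is the source
  of the recurring \<open>3 * w + 1 + m\<close>.\<close>

definition mass_G :: "real \<Rightarrow> real \<Rightarrow> real" where
  "mass_G w m = 2 * ((w + 1) * ellK m - ellE m) / sqrt (3 * w + 1 + m)"

definition momentum_G :: "real \<Rightarrow> real \<Rightarrow> real" where
  "momentum_G w m = 2 * sqrt (w * (w + 1) * (w + m)) * ellK m / (3 * w + 1 + m)"

text \<open>This and the next three definitions are partial derivatives, written over positive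
  denominators common to each pair, so that all questions of sign concern numerators only.\<close>

definition mass_G_dw :: "real \<Rightarrow> real \<Rightarrow> real" where
  "mass_G_dw w m = (2 * (3 * w + 1 + m) * ellK m - 3 * ((w + 1) * ellK m - ellE m))
     / ((3 * w + 1 + m) * sqrt (3 * w + 1 + m))"

definition mass_G_dm :: "real \<Rightarrow> real \<Rightarrow> real" where
  "mass_G_dm w m = ((3 * w + 1 + m) * (w * (ellE m - (1 - m) * ellK m) + m * ellE m)
       / (m * (1 - m)) - ((w + 1) * ellK m - ellE m))
     / ((3 * w + 1 + m) * sqrt (3 * w + 1 + m))"

definition momentum_G_dw :: "real \<Rightarrow> real \<Rightarrow> real" where
  "momentum_G_dw w m = ellK m * (((w + 1) * (w + m) + w * (w + m) + w * (w + 1)) * (3 * w + 1 + m)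
       - 6 * (w * (w + 1) * (w + m)))
     / (sqrt (w * (w + 1) * (w + m)) * (3 * w + 1 + m)^2)"

definition momentum_G_dm :: "real \<Rightarrow> real \<Rightarrow> real" where
  "momentum_G_dm w m = w * (w + 1) * (ellK m * (3 * w + 1 + m)
       + (w + m) * (ellE m - (1 - m) * ellK m) * (3 * w + 1 + m) / (m * (1 - m))
       - 2 * (w + m) * ellK m)
     / (sqrt (w * (w + 1) * (w + m)) * (3 * w + 1 + m)^2)"

lemma has_derivative_ell_snd:
  fixes p :: "real \<times> real"
  assumes "0 < snd p" "snd p < 1"
  shows "((\<lambda>p. ellK (snd p)) has_derivative
      (\<lambda>h. snd h * ((ellE (snd p) - (1 - snd p) * ellK (snd p)) / (2 * snd p * (1 - snd p))))) (at p)"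
    and "((\<lambda>p. ellE (snd p)) has_derivative (\<lambda>h. snd h * ((ellE (snd p) - ellK (snd p)) / (2 * snd p)))) (at p)"
proof -
  have s: "(snd has_derivative snd) (at p)" by (rule has_derivative_snd[OF has_derivative_ident])
  show "((\<lambda>p. ellK (snd p)) has_derivative
      (\<lambda>h. snd h * ((ellE (snd p) - (1 - snd p) * ellK (snd p)) / (2 * snd p * (1 - snd p))))) (at p)"
    using has_derivative_compose[OF s ellK_has_derivative[of "snd p", unfolded has_field_derivative_def]] assms
    by (simp add: mult.commute)
  show "((\<lambda>p. ellE (snd p)) has_derivative (\<lambda>h. snd h * ((ellE (snd p) - ellK (snd p)) / (2 * snd p)))) (at p)"
    using has_derivative_compose[OF s ellE_has_derivative[of "snd p", unfolded has_field_derivative_def]] assms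
    by (simp add: mult.commute)
qed

lemma mass_G_has_derivative:
  assumes "0 \<le> w" "0 < m" "m < 1"
  shows "((\<lambda>p. mass_G (fst p) (snd p)) has_derivative
     (\<lambda>h. fst h * mass_G_dw w m + snd h * mass_G_dm w m)) (at (w, m))"
proof -
  define K E D where "K = ellK m" and "E = ellE m" and "D = 3 * w + 1 + m"
  define r where "r = sqrt D"
  define K' E' where "K' = (E - (1 - m) * K) / (2 * m * (1 - m))" and "E' = (E - K) / (2 * m)"
  have r: "r > 0" "r * r = D" and D: "D > 0" using assms unfolding r_def D_def by auto
  note dK = has_derivative_ell_snd(1)[of "(w,m)", unfolded fst_conv snd_conv, OF assms(2,3),
      folded K_def E_def, folded K'_def]
  note dE = has_derivative_ell_snd(2)[of "(w,m)", unfolded fst_conv snd_conv, OF assms(2,3),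
      folded K_def E_def, folded E'_def]
  have "((\<lambda>p. mass_G (fst p) (snd p)) has_derivative
      (\<lambda>h. ((2 * (fst h * K + (w + 1) * (snd h * K') - snd h * E')) * r
        - 2 * ((w + 1) * K - E) * ((3 * fst h + snd h) / (2 * r))) / (r * r))) (at (w, m))"
    unfolding mass_G_def using r(1)
    by (auto intro!: derivative_eq_intros dK dE simp: D_def K_def E_def r_def assms)
      (auto simp: D_def[symmetric] field_simps)
  moreover have "((2 * (a * K + (w + 1) * (b * K') - b * E')) * r
        - 2 * ((w + 1) * K - E) * ((3 * a + b) / (2 * r))) / (r * r)
       = a * mass_G_dw w m + b * mass_G_dm w m" for a b
  proof -
    have N: "(w + 1) * K' - E' = (w * (E - (1 - m) * K) + m * E) / (2 * m * (1 - m))"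
      unfolding K'_def E'_def using assms by (simp add: divide_simps) (simp add: algebra_simps)
    have "((2 * (a * K + (w + 1) * (b * K') - b * E')) * r
        - 2 * ((w + 1) * K - E) * ((3 * a + b) / (2 * r))) / (r * r)
      = (2 * (r * r) * (a * K + b * ((w + 1) * K' - E')) - ((w + 1) * K - E) * (3 * a + b)) / ((r * r) * r)"
      using r(1) by (simp add: divide_simps) (simp add: algebra_simps)
    also have "\<dots> = (2 * D * (a * K + b * ((w * (E - (1 - m) * K) + m * E) / (2 * m * (1 - m)))) - ((w + 1) * K - E) * (3 * a + b)) / (D * r)"
      unfolding r(2) N ..
    also have "\<dots> = a * ((2 * D * K - 3 * ((w + 1) * K - E)) / (D * r)) +
        b * ((D * (w * (E - (1 - m) * K) + m * E) / (m * (1 - m)) - ((w + 1) * K - E)) / (D * r))"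
      using r(1) D assms by (simp add: divide_simps) (simp add: algebra_simps)
    finally show ?thesis unfolding mass_G_dw_def mass_G_dm_def K_def E_def D_def r_def .
  qed
  ultimately show ?thesis by simp
qed

lemma momentum_G_has_derivative:
  assumes "0 < w" "0 < m" "m < 1"
  shows "((\<lambda>p. momentum_G (fst p) (snd p)) has_derivative
     (\<lambda>h. fst h * momentum_G_dw w m + snd h * momentum_G_dm w m)) (at (w, m))"
proof -
  define K E D where "K = ellK m" and "E = ellE m" and "D = 3 * w + 1 + m"
  define r where "r = sqrt (w * (w + 1) * (w + m))"
  define K' where "K' = (E - (1 - m) * K) / (2 * m * (1 - m))"
  have r: "r > 0" "r * r = w * (w + 1) * (w + m)" and D: "D > 0" using assms unfolding r_def D_def by auto
  note dK = has_derivative_ell_snd(1)[of "(w,m)", unfolded fst_conv snd_conv, OF assms(2,3),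
      folded K_def E_def, folded K'_def]
  define S' where "S' = (\<lambda>a b. a * ((w + 1) * (w + m) + w * (w + m) + w * (w + 1)) + b * (w * (w + 1)))"
  have ds: "((\<lambda>p. sqrt (fst p * (fst p + 1) * (fst p + snd p))) has_derivative
      (\<lambda>h. S' (fst h) (snd h) / (2 * r))) (at (w, m))"
    using r(1) unfolding r_def
    by (auto intro!: derivative_eq_intros simp: S'_def field_simps)
  have "((\<lambda>p. momentum_G (fst p) (snd p)) has_derivative
      (\<lambda>h. ((2 * (S' (fst h) (snd h) / (2 * r)) * K + 2 * r * (snd h * K')) * D
        - 2 * r * K * (3 * fst h + snd h)) / (D * D))) (at (w, m))"
  proof -
    have dD: "((\<lambda>p. 3 * fst p + 1 + snd p) has_derivative (\<lambda>h. 3 * fst h + snd h)) (at (w, m))"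
      by (auto intro!: derivative_eq_intros)
    have nz: "3 * fst (w, m) + 1 + snd (w, m) \<noteq> 0" using D unfolding D_def by simp
    show ?thesis
      unfolding momentum_G_def
      by (rule has_derivative_eq_rhs[OF has_derivative_divide'[OF
            has_derivative_mult[OF has_derivative_mult[OF has_derivative_const ds] dK] dD nz]])
        (simp add: D_def K_def r_def algebra_simps)
  qed
  moreover have "((2 * (S' a b / (2 * r)) * K + 2 * r * (b * K')) * D - 2 * r * K * (3 * a + b)) / (D * D)
       = a * momentum_G_dw w m + b * momentum_G_dm w m" for a b
  proof -
    have "((2 * (S' a b / (2 * r)) * K + 2 * r * (b * K')) * D - 2 * r * K * (3 * a + b)) / (D * D)
      = ((S' a b * K + 2 * (r * r) * (b * K')) * D - 2 * (r * r) * K * (3 * a + b)) / (r * D^2)"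
      using r(1) D by (simp add: divide_simps power2_eq_square)
    also have "\<dots> = a * (K * (((w + 1) * (w + m) + w * (w + m) + w * (w + 1)) * D
       - 6 * (w * (w + 1) * (w + m))) / (r * D^2)) + b * (w * (w + 1) * (K * D
       + (w + m) * (E - (1 - m) * K) * D / (m * (1 - m))
       - 2 * (w + m) * K) / (r * D^2))"
      unfolding r(2) K'_def S'_def using r(1) D assms
      by (simp add: divide_simps) (simp add: algebra_simps)
    finally show ?thesis unfolding momentum_G_dw_def momentum_G_dm_def K_def E_def D_def r_def .
  qed
  ultimately show ?thesis by simp
qed


text \<open>Regrouping the numerator around \<open>E - (1 - m) K\<close> leaves no negative
  term.\<close>

lemma mass_G_dw_pos:
  assumes "0 \<le> w" "0 \<le> m" "m < 1" shows "0 < mass_G_dw w m"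
proof -
  have "2 * (3 * w + 1 + m) * ellK m - 3 * ((w + 1) * ellK m - ellE m)
      = (3 * w + 2 - m) * ellK m + 3 * (ellE m - (1 - m) * ellK m)"
    by (simp add: algebra_simps)
  also have "\<dots> > 0"
    using ellK_ge_1[of m] ellE_ge[of m] assms by (intro add_pos_nonneg mult_pos_pos) auto
  finally show ?thesis using assms unfolding mass_G_dw_def by simp
qed

text \<open>With \<open>D = 3 w + 1 + m\<close>, the bound \<open>(1 - m) K <= E\<close> makes
  \<open>D m E / (m (1 - m))\<close> at least \<open>D K\<close>, which already exceeds the
  subtracted \<open>(w + 1) K - E\<close>.\<close>

lemma mass_G_dm_pos:
  assumes "0 \<le> w" "0 < m" "m < 1" shows "0 < mass_G_dm w m"
proof -
  define K E D where "K = ellK m" and "E = ellE m" and "D = 3 * w + 1 + m"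
  have K: "K \<ge> 1" and E: "E \<ge> 1" "(1 - m) * K \<le> E"
    using ellK_ge_1[of m] ellE_ge[of m] ellE_ge_1[of m] assms unfolding K_def E_def by auto
  have "(w + 1) * K - E < D * K"
  proof -
    have "0 \<le> w * K" "0 \<le> m * K" using K assms by auto
    then show ?thesis using E unfolding D_def by (simp add: algebra_simps)
  qed
  also have "D * K \<le> D * (m * E) / (m * (1 - m))"
  proof -
    have "K \<le> E / (1 - m)" using E(2) assms by (simp add: field_simps)
    then have "D * K \<le> D * (E / (1 - m))" using assms unfolding D_def by (intro mult_left_mono) auto
    also have "\<dots> = D * (m * E) / (m * (1 - m))" using assms by simp
    finally show ?thesis .
  qed
  also have "\<dots> \<le> D * (w * (E - (1 - m) * K) + m * E) / (m * (1 - m))"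
    using assms E unfolding D_def by (intro divide_right_mono mult_left_mono) auto
  finally show ?thesis using assms unfolding mass_G_dm_def K_def E_def D_def by simp
qed

text \<open>After clearing denominators the Jacobian is a cubic in \<open>w\<close> whose coefficients are quadratic
  forms in \<open>K\<close> and \<open>E\<close>, each of them nonnegative because \<open>(1 - m) K \<le> E \<le> (1 - m/2) K\<close>.\<close>

lemma jacobian_G_pos:
  assumes "0 < w" "0 < m" "m < 1"
  shows "0 < mass_G_dm w m * momentum_G_dw w m - mass_G_dw w m * momentum_G_dm w m"
proof -
  define K E D where "K = ellK m" and "E = ellE m" and "D = 3 * w + 1 + m"
  have K: "K \<ge> 1" and E: "E \<ge> 1" "(1 - m) * K \<le> E" "E \<le> (1 - m/2) * K" "E \<le> K"
    using ellK_ge_1[of m] ellE_ge[of m] ellE_ge_1[of m] ellE_le[of m] ellE_le_ellK[of m] assms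
    unfolding K_def E_def by auto
  define r s where "r = sqrt D" and "s = sqrt (w * (w + 1) * (w + m))"
  have pos: "D > 0" "r > 0" "s > 0" using assms unfolding D_def r_def s_def by auto
  define X where "X = 2 * D * K - 3 * ((w + 1) * K - E)"
  define Y where "Y = D * (w * (E - (1 - m) * K) + m * E) / (m * (1 - m)) - ((w + 1) * K - E)"
  define U where "U = K * (((w + 1) * (w + m) + w * (w + m) + w * (w + 1)) * D - 6 * (w * (w + 1) * (w + m)))"
  define V where "V = w * (w + 1) * (K * D + (w + m) * (E - (1 - m) * K) * D / (m * (1 - m)) - 2 * (w + m) * K)"
  define c0 c1 c2 c3 where "c0 = K * ((m - 1) * K + 2 * E)" and "c1 = m * K^2 - (K - E)^2"
    and "c2 = (K - E) * (m * (K + E) - (K - E))" and "c3 = m * K * (K - 2 * E) + (K - E) * (3 * E - K)"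
  \<comment> \<open>The factor \<open>m (1 - m)\<close> clears the denominators that the derivatives
    of K and E bring into \<open>Y\<close> and \<open>V\<close>; a factor \<open>D\<close> then
    splits off and leaves the cubic.\<close>
  have "m * (1 - m) * (Y * U - X * V) = D * (m^2 * c0 + 3 * m * w * c1 + 3 * w^2 * c2 + w^3 * c3)"
  proof -
    have Y: "m * (1 - m) * Y = D * (w * (E - (1 - m) * K) + m * E) - m * (1 - m) * ((w + 1) * K - E)"
      unfolding Y_def using assms by (simp add: right_diff_distrib)
    have V: "m * (1 - m) * V = w * (w + 1) * (m * (1 - m) * K * D + (w + m) * (E - (1 - m) * K) * D - m * (1 - m) * (2 * (w + m) * K))"
      unfolding V_def using assms by (simp add: field_simps)
    have "m * (1 - m) * (Y * U - X * V) = (m * (1 - m) * Y) * U - X * (m * (1 - m) * V)"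
      by (simp add: algebra_simps)
    also have "\<dots> = D * (m^2 * c0 + 3 * m * w * c1 + 3 * w^2 * c2 + w^3 * c3)"
      unfolding Y V U_def X_def c0_def c1_def c2_def c3_def D_def by algebra
    finally show ?thesis .
  qed
  moreover have "0 < D * (m^2 * c0 + 3 * m * w * c1 + 3 * w^2 * c2 + w^3 * c3)"
  proof -
    have "c0 > 0" unfolding c0_def using K E by (intro mult_pos_pos) (auto simp: algebra_simps)
    moreover have "c1 \<ge> 0"
    proof -
      have "K - E \<le> m * K" "0 \<le> K - E" using E by (auto simp: algebra_simps)
      then have "(K - E)^2 \<le> (m * K)^2" by (intro power_mono)
      also have "\<dots> \<le> m * K^2"
      proof -
        have "0 \<le> m * K^2" using assms by simp
        then have "m * (m * K^2) \<le> 1 * (m * K^2)" using assms by (intro mult_right_mono) auto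
        then show ?thesis by (simp add: power2_eq_square algebra_simps)
      qed
      finally show ?thesis unfolding c1_def by simp
    qed
    moreover have "c2 \<ge> 0"
    proof -
      have "0 \<le> m * E" using E assms by simp
      then show ?thesis unfolding c2_def using E by (intro mult_nonneg_nonneg) (auto simp: algebra_simps)
    qed
    moreover have "c3 \<ge> 0"
    proof -
      \<comment> \<open>\<open>c3\<close> is written in the two gaps \<open>E - (1 - m) K\<close>
        and \<open>(1 - m/2) K - E\<close>. The sharp upper bound on E is essential here: at
        \<open>E = K\<close> the value would be \<open>- m K^2\<close>.\<close>
      have "c3 = 3 * (E - (1 - m) * K) * ((1 - m/2) * K - E) + m / 2 * K * (E - (1 - m) * K)
          + 2 * (1 - m) * K * ((1 - m/2) * K - E)"
        unfolding c3_def by (simp add: field_simps power2_eq_square)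
      also have "\<dots> \<ge> 0" using E K assms by (intro add_nonneg_nonneg mult_nonneg_nonneg) auto
      finally show ?thesis .
    qed
    ultimately show ?thesis using assms pos
      by (intro mult_pos_pos add_pos_nonneg mult_nonneg_nonneg) auto
  qed
  moreover have "0 < m * (1 - m)" using assms by simp
  ultimately have "0 < Y * U - X * V" by (metis zero_less_mult_pos)
  moreover have "mass_G_dm w m * momentum_G_dw w m - mass_G_dw w m * momentum_G_dm w m
      = (Y / (D * r)) * (U / (s * D^2)) - (X / (D * r)) * (V / (s * D^2))"
    unfolding mass_G_dm_def momentum_G_dw_def mass_G_dw_def momentum_G_dm_def
      X_def Y_def U_def V_def r_def s_def D_def K_def E_def ..
  moreover have "\<dots> = (Y * U - X * V) / ((D * r) * (s * D^2))"
    by (simp add: diff_divide_distrib)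
  ultimately show ?thesis using pos by simp
qed

text \<open>The edges are degenerate waves: \<open>w = 0\<close> means \<open>s1 = 0\<close>, that
  is \<open>J = 0\<close>; \<open>m = 0\<close> means \<open>s1 = s2\<close>; \<open>m = 1\<close>
  means \<open>s2 = s3\<close>.\<close>

definition Omega :: "(real \<times> real) set" where "Omega = {0<..} \<times> {0<..<1}"

definition G_map :: "real \<times> real \<Rightarrow> real \<times> real" where
  "G_map p = (mass_G (fst p) (snd p), momentum_G (fst p) (snd p))"

lemma open_Omega: "open Omega"
  unfolding Omega_def by (intro open_Times) auto

lemma smooth_on_G_map: "smooth_on Omega G_map"
proof -
  have O: "0 < fst p" "0 < snd p" "snd p < 1" if "p \<in> Omega" for p
    using that unfolding Omega_def by (auto simp: mem_Times_iff)
  have K: "Ck_on k Omega (\<lambda>p. ellK (snd p))" and E: "Ck_on k Omega (\<lambda>p. ellE (snd p))" for k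
    using Ck_on_ellK_ellE[of Omega snd k] Ck_on_snd O by blast+
  have D: "0 < 3 * fst p + 1 + snd p" and S: "0 < fst p * (fst p + 1) * (fst p + snd p)"
    if "p \<in> Omega" for p using O[OF that] by auto
  note rules = Ck_on_divide Ck_on_mult Ck_on_const Ck_on_diff Ck_on_add Ck_on_sqrt Ck_on_fst Ck_on_snd K E
  have "Ck_on k Omega (\<lambda>p. fst (G_map p))" "Ck_on k Omega (\<lambda>p. snd (G_map p))" for k
    unfolding G_map_def mass_G_def momentum_G_def fst_conv snd_conv
    by (rule rules | use D S in force)+
  then show ?thesis unfolding smooth_on_def by blast
qed

section \<open>Level curves of the mass\<close>

lemma has_field_derivative_along_graph:
  fixes F :: "real \<times> real \<Rightarrow> real"
  assumes "(F has_derivative (\<lambda>h. fst h * A + snd h * B)) (at (x t, t))"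
    and "(x has_field_derivative x') (at t)"
  shows "((\<lambda>t. F (x t, t)) has_field_derivative (x' * A + B)) (at t)"
proof -
  have "((\<lambda>t. (x t, t)) has_derivative (\<lambda>h. (x' * h, h))) (at t)"
    using assms(2) by (intro has_derivative_Pair has_derivative_ident) (simp add: has_field_derivative_def)
  from has_derivative_compose[OF this assms(1)] show ?thesis
    unfolding has_field_derivative_def
    by (rule has_derivative_eq_rhs) (simp add: fun_eq_iff algebra_simps)
qed

text \<open>Proved apart from the total derivative so as to include \<open>m = 0\<close>, the edge
  from which the level curves start.\<close>

lemma mass_G_has_derivative_w:
  assumes "0 \<le> w" "0 \<le> m" "m < 1"
  shows "((\<lambda>w. mass_G w m) has_real_derivative mass_G_dw w m) (at w)"
proof -
  have D: "3 * w + 1 + m > 0" using assms by simp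
  define r where "r = sqrt (3 * w + 1 + m)"
  have r: "r > 0" "r * r = 3 * w + 1 + m" using D unfolding r_def by auto
  have "((\<lambda>w. mass_G w m) has_real_derivative
      ((2 * ellK m) * r - 2 * ((w + 1) * ellK m - ellE m) * (3 / (2 * r))) / (r * r)) (at w)"
    unfolding mass_G_def using D
    by (auto intro!: derivative_eq_intros simp: r_def field_simps)
  moreover have "((2 * ellK m) * r - 2 * ((w + 1) * ellK m - ellE m) * (3 / (2 * r))) / (r * r)
      = (2 * (r * r) * ellK m - 3 * ((w + 1) * ellK m - ellE m)) / ((r * r) * r)"
    using r(1) by (simp add: field_simps)
  ultimately show ?thesis unfolding r(2) by (simp add: mass_G_dw_def r_def)
qed

lemma mass_G_strict_mono_w:
  assumes "0 \<le> w" "w < w'" "0 \<le> m" "m < 1"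
  shows "mass_G w m < mass_G w' m"
proof (rule DERIV_pos_imp_increasing[OF assms(2)])
  fix x assume "w \<le> x" "x \<le> w'"
  then show "\<exists>y. ((\<lambda>w. mass_G w m) has_real_derivative y) (at x) \<and> 0 < y"
    using mass_G_has_derivative_w[of x m] mass_G_dw_pos[of x m] assms by auto
qed

lemma isCont_mass_G:
  assumes "0 \<le> w" "0 \<le> m" "m < 1" shows "isCont (mass_G w) m"
  unfolding mass_G_def using assms
  by (auto intro!: continuous_intros continuous_ellK continuous_ellE)

lemma mass_G_strict_mono_m:
  assumes "0 \<le> w" "0 \<le> m" "m < m'" "m' < 1"
  shows "mass_G w m < mass_G w m'"
proof (rule DERIV_pos_imp_increasing_open[OF assms(3)])
  fix x assume "m < x" "x < m'"
  then show "\<exists>y. (mass_G w has_real_derivative y) (at x) \<and> 0 < y"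
    using has_field_derivative_along_graph[where x="\<lambda>_. w" and x'=0, OF mass_G_has_derivative[of w x]]
      mass_G_dm_pos[of w x] assms by auto
next
  show "continuous_on {m..m'} (mass_G w)"
    using assms by (auto intro!: continuous_at_imp_continuous_on isCont_mass_G)
qed

text \<open>On the edge \<open>w = 0\<close> the mass runs from 0 to infinity, by the logarithmic
  growth of \<open>K - E\<close>. The \<open>m\<close> found here is the right end of the level
  curve of mass \<open>c\<close>.\<close>

lemma ex_mass_G_0:
  assumes "0 < c" obtains m where "0 < m" "m < 1" "mass_G 0 m = c"
proof -
  \<comment> \<open>Chosen so that \<open>- ln (1 - b) / 2 = c\<close>; the factor 2 in
    \<open>mass_G\<close> then outweighs \<open>sqrt (1 + b) <= 2\<close>.\<close>
  define b where "b = 1 - exp (- 2 * c)"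
  have b: "0 < b" "b < 1" "ln (1 - b) = - 2 * c" using assms unfolding b_def by auto
  have "2 * c \<le> 2 * (ellK b - ellE b)" using ellK_minus_ellE_ge[of b] b by simp
  moreover have "0 < sqrt (1 + b)" "sqrt (1 + b) \<le> 2"
    using b by (auto intro: real_le_lsqrt)
  ultimately have "2 * c / 2 \<le> 2 * (ellK b - ellE b) / sqrt (1 + b)"
    using assms by (intro frac_le) auto
  then have "c \<le> mass_G 0 b" unfolding mass_G_def by simp
  moreover have m0: "mass_G 0 0 = 0" by (simp add: mass_G_def ellK_0 ellE_0)
  moreover have "continuous_on {0..b} (mass_G 0)"
    using b by (auto intro!: continuous_at_imp_continuous_on isCont_mass_G)
  ultimately obtain m where m: "0 \<le> m" "m \<le> b" "mass_G 0 m = c"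
    using IVT'[of "mass_G 0" 0 c b] assms b by auto
  then have "m \<noteq> 0" using m0 assms by auto
  with m b show ?thesis by (intro that[of m]) auto
qed

lemma ex_mass_G:
  assumes "0 \<le> m" "m < 1" "mass_G 0 m < c"
  obtains w where "0 < w" "mass_G w m = c"
proof -
  \<comment> \<open>The mass grows like \<open>sqrt w\<close>, so \<open>w\<close> of order
    \<open>c^2\<close> is enough: \<open>c^2 (3 b + 2) = (b - 1) (3 b + 2)\<close> is below
    \<open>(2 b)^2\<close>, while the numerator of \<open>mass_G b m\<close> is at least
    \<open>2 b\<close>.\<close>
  define b where "b = c^2 + 1"
  have b: "b \<ge> 1" "c^2 = b - 1" unfolding b_def by auto
  have "c < mass_G b m"
  proof -
    have "c * sqrt (3 * b + 1 + m) \<le> sqrt (c^2 * (3 * b + 1 + m))"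
      using mult_right_mono[OF abs_ge_self[of c], of "sqrt (3 * b + 1 + m)"] b(1) assms(1)
      by (simp add: real_sqrt_mult)
    also have "\<dots> < sqrt ((2 * b)^2)"
    proof (rule real_sqrt_less_mono)
      have "c^2 * (3 * b + 1 + m) \<le> c^2 * (3 * b + 2)" using assms by (intro mult_left_mono) auto
      also have "\<dots> = 3 * b^2 - b - 2" unfolding b(2) by (simp add: power2_eq_square algebra_simps)
      also have "\<dots> < (2 * b)^2"
        using b(1) zero_le_power2[of b] unfolding power2_eq_square by linarith
      finally show "c^2 * (3 * b + 1 + m) < (2 * b)^2" .
    qed
    also have "\<dots> = 2 * b" unfolding real_sqrt_abs using b by simp
    also have "2 * b \<le> 2 * ((b + 1) * ellK m - ellE m)"
    proof -
      have "b * 1 \<le> b * ellK m" using ellK_ge_1[of m] assms b by (intro mult_left_mono) auto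
      then show ?thesis using ellE_le_ellK[of m] assms by (simp add: algebra_simps)
    qed
    finally show ?thesis unfolding mass_G_def using b assms by (simp add: field_simps)
  qed
  moreover have "continuous_on {0..b} (\<lambda>w. mass_G w m)"
    using mass_G_has_derivative_w[of _ m] assms
    by (auto intro!: continuous_at_imp_continuous_on DERIV_isCont)
  ultimately obtain w where "0 \<le> w" "w \<le> b" "mass_G w m = c"
    using IVT'[of "\<lambda>w. mass_G w m" 0 c b] assms b by auto
  with assms(3) show ?thesis by (intro that[of w]) (cases "w = 0", auto)
qed

text \<open>The level curve \<open>mass_G w m = c\<close> solved for \<open>w\<close>; meaningful only if \<open>mass_G 0 m < c\<close>.\<close>

definition level_w :: "real \<Rightarrow> real \<Rightarrow> real" where
  "level_w c m = fst (inv_into Omega (\<lambda>p. (mass_G (fst p) (snd p), snd p)) (c, m))"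

lemma inj_on_mass_G: "inj_on (\<lambda>p. (mass_G (fst p) (snd p), snd p)) Omega"
proof (rule inj_onI)
  fix p q assume *: "p \<in> Omega" "q \<in> Omega"
    "(mass_G (fst p) (snd p), snd p) = (mass_G (fst q) (snd q), snd q)"
  then have "\<not> fst p < fst q" "\<not> fst q < fst p"
    using mass_G_strict_mono_w[of "fst p" "fst q" "snd q"] mass_G_strict_mono_w[of "fst q" "fst p" "snd q"]
    unfolding Omega_def by (auto simp: mem_Times_iff)
  with * show "p = q" by (simp add: prod_eq_iff)
qed

lemma level_w_eq:
  assumes "0 < w" "0 < m" "m < 1" shows "level_w (mass_G w m) m = w"
  using inv_into_f_f[OF inj_on_mass_G, of "(w, m)"] assms unfolding level_w_def Omega_def by simp

lemma level_w:
  assumes "0 < m" "m < 1" "mass_G 0 m < c"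
  shows "0 < level_w c m" "mass_G (level_w c m) m = c"
proof -
  obtain w where "0 < w" "mass_G w m = c" using ex_mass_G[of m c] assms by auto
  then show "0 < level_w c m" "mass_G (level_w c m) m = c"
    using level_w_eq[of w m] assms by auto
qed

text \<open>Implicit differentiation by way of the inverse function theorem: the map
  \<open>(w, m)\<close> to \<open>(mass, m)\<close> has a triangular derivative with determinant
  \<open>mass_G_dw\<close>.\<close>

lemma level_w_has_derivative:
  assumes "0 < m" "m < 1" "mass_G 0 m < c"
  shows "(level_w c has_field_derivative - (mass_G_dm (level_w c m) m / mass_G_dw (level_w c m) m)) (at m)"
proof -
  define w where "w = level_w c m"
  have w: "0 < w" "mass_G w m = c" using level_w[OF assms] unfolding w_def by auto
  define H where "H = (\<lambda>p::real \<times> real. (mass_G (fst p) (snd p), snd p))"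
  have "continuous_on Omega (\<lambda>p. mass_G (fst p) (snd p))"
    using smooth_on_imp_continuous_on[OF smooth_on_G_map] unfolding G_map_def
    by (auto dest: continuous_on_fst)
  then have cH: "continuous_on Omega H"
    unfolding H_def by (intro continuous_on_Pair continuous_on_snd continuous_on_id)
  have wO: "(w, m) \<in> Omega" using w assms unfolding Omega_def by simp
  have dw: "mass_G_dw w m > 0" using mass_G_dw_pos[of w m] w assms by simp
  have "(inv_into Omega H has_derivative (\<lambda>h. ((fst h * 1 - snd h * mass_G_dm w m) / (mass_G_dw w m * 1 - mass_G_dm w m * 0),
    (snd h * mass_G_dw w m - fst h * 0) / (mass_G_dw w m * 1 - mass_G_dm w m * 0)))) (at (H (w, m)))"
  proof (rule has_derivative_inverse_plane[OF open_Omega wO _ cH])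
    show "inj_on H Omega" unfolding H_def by (rule inj_on_mass_G)
    show "((\<lambda>p. fst (H p)) has_derivative (\<lambda>h. fst h * mass_G_dw w m + snd h * mass_G_dm w m)) (at (w, m))"
      unfolding H_def using mass_G_has_derivative[of w m] w assms by simp
    show "((\<lambda>p. snd (H p)) has_derivative (\<lambda>h. fst h * 0 + snd h * 1)) (at (w, m))"
      unfolding H_def by (simp add: has_derivative_snd[OF has_derivative_ident])
  qed (use dw in simp)
  then have "((\<lambda>y. fst (inv_into Omega H y)) has_derivative (\<lambda>h. (fst h - snd h * mass_G_dm w m) / mass_G_dw w m)) (at (c, m))"
    using has_derivative_fst w(2) unfolding H_def by fastforce
  then have "((\<lambda>t. fst (inv_into Omega H (c, t))) has_field_derivative
      (0 * (1 / mass_G_dw w m) + - (mass_G_dm w m / mass_G_dw w m))) (at m)"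
    by (intro has_field_derivative_along_graph[where x="\<lambda>_. c" and x'=0]) (auto simp: diff_divide_distrib)
  then show ?thesis unfolding level_w_def H_def w_def by simp
qed

text \<open>By the chain rule the derivative is minus the determinant in
  \<open>jacobian_G_pos\<close>, divided by the positive \<open>mass_G_dw\<close>.\<close>

lemma momentum_level_has_derivative_neg:
  assumes "0 < m" "m < 1" "mass_G 0 m < c"
  obtains d where "((\<lambda>m. momentum_G (level_w c m) m) has_real_derivative d) (at m)" "d < 0"
proof -
  define w where "w = level_w c m"
  have w: "0 < w" using level_w[OF assms] unfolding w_def by auto
  have dw: "mass_G_dw w m > 0" using mass_G_dw_pos[of w m] w assms by simp
  let ?d = "- (mass_G_dm w m / mass_G_dw w m) * momentum_G_dw w m + momentum_G_dm w m"
  have "((\<lambda>t. (\<lambda>p. momentum_G (fst p) (snd p)) (level_w c t, t)) has_real_derivative ?d) (at m)"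
    unfolding w_def
    by (intro has_field_derivative_along_graph level_w_has_derivative assms
        momentum_G_has_derivative level_w)
  moreover have "?d = - (mass_G_dm w m * momentum_G_dw w m - mass_G_dw w m * momentum_G_dm w m) / mass_G_dw w m"
    using dw by (simp add: field_simps)
  then have "?d < 0" using jacobian_G_pos[OF w assms(1,2)] dw by (simp add: field_simps)
  ultimately show ?thesis using that by auto
qed

lemma momentum_level_strict_antimono:
  assumes "0 < m" "m < m'" "m' < 1" "mass_G 0 m' < c"
  shows "momentum_G (level_w c m') m' < momentum_G (level_w c m) m"
proof (rule DERIV_neg_imp_decreasing[OF assms(2)])
  fix x assume x: "m \<le> x" "x \<le> m'"
  then have "mass_G 0 x < c" using mass_G_strict_mono_m[of 0 x m'] assms by (cases "x = m'") auto
  then show "\<exists>y. ((\<lambda>m. momentum_G (level_w c m) m) has_real_derivative y) (at x) \<and> y < 0"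
    using momentum_level_has_derivative_neg[of x c] x assms by (metis less_le_trans le_less_trans)
qed

section \<open>The limit of the momentum at \<open>m = 0\<close>\<close>

definition momentum_max :: "real \<Rightarrow> real" where
  "momentum_max c = c / pi * sqrt (3 * c^2 + pi^2 - sqrt (9 * c^4 + 4 * c^2 * pi^2))"

text \<open>At \<open>m = 0\<close> both K and E equal \<open>pi / 2\<close>, so the mass is
  \<open>pi x\<close> with \<open>x = w / sqrt (3 w + 1)\<close>. The nested root resolves because
  \<open>9 x^4 + 4 x^2\<close> is the square of \<open>w (3 w + 2) / (3 w + 1)\<close>.\<close>

lemma momentum_G_0:
  assumes "0 < w" shows "momentum_G w 0 = momentum_max (mass_G w 0)"
proof -
  define D where "D = 3 * w + 1"
  have D: "D > 0" using assms unfolding D_def by simp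
  define x where "x = w / sqrt D"
  have x: "x > 0" "x^2 = w^2 / D" using assms D unfolding x_def by (auto simp: power_divide)
  have c: "mass_G w 0 = pi * x" unfolding mass_G_def ellK_0 ellE_0 x_def D_def by (simp add: field_simps)
  have "9 * (pi * x)^4 + 4 * (pi * x)^2 * pi^2 = pi^4 * (9 * (x^2)^2 + 4 * x^2)"
    by (simp add: power_mult_distrib algebra_simps flip: power_mult power_add)
  also have "9 * (x^2)^2 + 4 * x^2 = (w * (3 * w + 2) / D)^2"
    unfolding x(2) using D
    by (simp add: power_divide divide_simps) (simp add: D_def algebra_simps power2_eq_square power4_eq_xxxx)
  also have "pi^4 * (w * (3 * w + 2) / D)^2 = (pi^2 * (w * (3 * w + 2) / D))^2"
    unfolding power_mult_distrib by (simp flip: power_mult)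
  finally have "sqrt (9 * (pi * x)^4 + 4 * (pi * x)^2 * pi^2) = pi^2 * (w * (3 * w + 2) / D)"
    using assms D by simp
  then have "3 * (pi * x)^2 + pi^2 - sqrt (9 * (pi * x)^4 + 4 * (pi * x)^2 * pi^2)
     = pi^2 * (3 * x^2 + 1 - w * (3 * w + 2) / D)"
    by (simp add: power_mult_distrib algebra_simps)
  also have "3 * x^2 + 1 - w * (3 * w + 2) / D = (w + 1) / D"
    unfolding x(2) using D by (simp add: divide_simps) (simp add: D_def algebra_simps power2_eq_square)
  finally have "momentum_max (mass_G w 0) = x * sqrt (pi^2 * ((w + 1) / D))"
    unfolding momentum_max_def c by simp
  also have "\<dots> = pi * w * sqrt (w + 1) / D"
    unfolding x_def using D by (simp add: real_sqrt_mult real_sqrt_divide)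
  also have "\<dots> = momentum_G w 0"
    unfolding momentum_G_def ellK_0 D_def using assms by (simp add: real_sqrt_mult)
  finally show ?thesis by simp
qed

text \<open>No formula for \<open>level_w\<close> is available near \<open>m = 0\<close>; it is
  squeezed. For fixed \<open>a\<close> on either side of \<open>w0\<close>,
  \<open>mass_G a m\<close> stays on its side of \<open>c\<close> for small \<open>m\<close>, and
  monotonicity in \<open>w\<close> locates \<open>level_w c m\<close>.\<close>

lemma tendsto_momentum_level:
  assumes "0 < c"
  shows "((\<lambda>m. momentum_G (level_w c m) m) \<longlongrightarrow> momentum_max c) (at_right 0)"
proof -
  obtain m1 where m1: "0 < m1" "m1 < 1" "mass_G 0 m1 = c" using ex_mass_G_0[OF assms] by metis
  have ev: "eventually (\<lambda>m. 0 < m \<and> m < m1) (at_right 0)"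
    using m1 by (auto simp: eventually_at_right)
  have lt: "mass_G 0 m < c" if "0 \<le> m" "m < m1" for m
    using mass_G_strict_mono_m[of 0 m m1] that m1 by simp
  obtain w0 where w0: "0 < w0" "mass_G w0 0 = c" using ex_mass_G[of 0 c] lt[of 0] m1 by auto
  have cont: "((\<lambda>m. mass_G a m) \<longlongrightarrow> mass_G a 0) (at_right 0)" if "0 \<le> a" for a
    using isCont_mass_G[of a 0] that by (simp add: isCont_def filterlim_at_split)
  have "(level_w c \<longlongrightarrow> w0) (at_right 0)"
  proof (rule order_tendstoI)
    fix a assume "a < w0"
    \<comment> \<open>Monotonicity of the mass in \<open>w\<close> is known only for
      \<open>w >= 0\<close>.\<close>
    define b where "b = max a 0"
    have b: "0 \<le> b" "a \<le> b" "b < w0" using \<open>a < w0\<close> w0 unfolding b_def by auto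
    have "mass_G b 0 < c" using mass_G_strict_mono_w[of b w0 0] b w0 by simp
    then have "eventually (\<lambda>m. mass_G b m < c) (at_right 0)" using cont[OF b(1)] order_tendstoD by blast
    with ev show "eventually (\<lambda>m. a < level_w c m) (at_right 0)"
    proof eventually_elim
      case (elim m)
      then have "0 < level_w c m" "mass_G (level_w c m) m = c" using level_w[of m c] lt m1 by auto
      then have "b < level_w c m"
        using mass_G_strict_mono_w[of "level_w c m" b m] elim m1 by (cases "level_w c m = b") force+
      then show ?case using b by simp
    qed
  next
    fix b assume b: "w0 < b"
    have "c < mass_G b 0" using mass_G_strict_mono_w[of w0 b 0] b w0 by simp
    then have "eventually (\<lambda>m. c < mass_G b m) (at_right 0)" using cont[of b] order_tendstoD b w0 by force
    with ev show "eventually (\<lambda>m. level_w c m < b) (at_right 0)"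
    proof eventually_elim
      case (elim m)
      then have "0 < level_w c m" "mass_G (level_w c m) m = c" using level_w[of m c] lt m1 by auto
      then show ?case
        using mass_G_strict_mono_w[of b "level_w c m" m] elim m1 b w0 by (cases "level_w c m = b") force+
    qed
  qed
  moreover have "(ellK \<longlongrightarrow> ellK 0) (at_right 0)"
    using continuous_ellK[of 0] by (simp add: isCont_def filterlim_at_split)
  ultimately have "((\<lambda>m. momentum_G (level_w c m) m) \<longlongrightarrow> momentum_G w0 0) (at_right 0)"
    unfolding momentum_G_def using w0 by (intro tendsto_intros) auto
  then show ?thesis using momentum_G_0 w0 by simp
qed

lemma momentum_G_less_max:
  assumes "0 < w" "0 < m" "m < 1"
  shows "momentum_G w m < momentum_max (mass_G w m)"
proof -
  define c where "c = mass_G w m"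
  define h where "h = (\<lambda>m. momentum_G (level_w c m) m)"
  have lt: "mass_G 0 m < c" unfolding c_def using mass_G_strict_mono_w[of 0 w m] assms by simp
  have "0 < c" using lt mass_G_strict_mono_m[of 0 0 m] assms by (simp add: mass_G_def ellK_0 ellE_0)
  have dec: "h y < h x" if "0 < x" "x < y" "y \<le> m" for x y
  proof -
    have "mass_G 0 y < c" using mass_G_strict_mono_m[of 0 y m] lt that assms by (cases "y = m") auto
    then show ?thesis unfolding h_def using momentum_level_strict_antimono[of x y c] that assms by auto
  qed
  \<comment> \<open>A limit yields only a weak inequality; comparing at \<open>m/2\<close> first
    makes the one at \<open>m\<close> strict.\<close>
  have "h (m/2) \<le> momentum_max c"
  proof (rule tendsto_lowerbound)
    show "(h \<longlongrightarrow> momentum_max c) (at_right 0)" unfolding h_def by (rule tendsto_momentum_level) fact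
    show "eventually (\<lambda>x. h (m/2) \<le> h x) (at_right 0)"
      unfolding eventually_at_right[OF zero_less_one]
      using dec[of _ "m/2"] assms by (intro exI[of _ "m/2"]) (auto intro: less_imp_le)
  qed simp
  then have "h m < momentum_max c" using dec[of "m/2" m] assms by simp
  then show ?thesis unfolding h_def c_def level_w_eq[OF assms] .
qed

text \<open>Points with the same image lie on one level curve of the mass, where the momentum
  determines \<open>m\<close>; mass and \<open>m\<close> then determine \<open>w\<close>.\<close>

lemma inj_on_G_map: "inj_on G_map Omega"
proof (rule inj_onI)
  have *: "\<not> snd p < snd q" if p: "p \<in> Omega" and q: "q \<in> Omega" and e: "G_map p = G_map q" for p q
  proof
    assume l: "snd p < snd q"
    define c where "c = mass_G (fst q) (snd q)"
    have O: "0 < fst p" "0 < snd p" "0 < fst q" "snd q < 1"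
      using p q unfolding Omega_def by (auto simp: mem_Times_iff)
    have c: "c = mass_G (fst p) (snd p)" "momentum_G (fst p) (snd p) = momentum_G (fst q) (snd q)"
      using e unfolding G_map_def c_def by auto
    have "mass_G 0 (snd q) < c" unfolding c_def using mass_G_strict_mono_w[of 0 "fst q" "snd q"] O l by simp
    from momentum_level_strict_antimono[OF O(2) l O(4) this] show False
      using level_w_eq[of "fst p" "snd p"] level_w_eq[of "fst q" "snd q"] O l c
      unfolding c_def by auto
  qed
  fix p q assume pq: "p \<in> Omega" "q \<in> Omega" "G_map p = G_map q"
  then have "snd p = snd q" using *[of p q] *[of q p] by auto
  with pq show "p = q"
    using inj_onD[OF inj_on_mass_G, of p q] by (simp add: G_map_def)
qed

lemma D_tilde_eq: "D_tilde = {(M, P). 0 < M \<and> 0 < P \<and> P < momentum_max M}"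
  unfolding D_tilde_def momentum_max_def ..

text \<open>For surjectivity the intermediate value theorem is applied to the momentum along the
  level curve of mass \<open>c\<close>, between a point \<open>ma\<close> near \<open>m = 0\<close>
  with momentum above \<open>P\<close> and a point \<open>mb\<close> near the other end with
  momentum below \<open>P\<close>.\<close>

lemma G_map_image: "G_map ` Omega = D_tilde"
proof
  show "G_map ` Omega \<subseteq> D_tilde"
  proof
    fix y assume "y \<in> G_map ` Omega"
    then obtain w m where wm: "0 < w" "0 < m" "m < 1" "y = (mass_G w m, momentum_G w m)"
      unfolding Omega_def G_map_def by auto
    have "0 < mass_G w m"
      using mass_G_strict_mono_w[of 0 w m] mass_G_strict_mono_m[of 0 0 m] wm
      by (simp add: mass_G_def ellK_0 ellE_0)
    moreover have "0 < momentum_G w m"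
      using wm ellK_ge_1[of m] unfolding momentum_G_def by simp
    ultimately show "y \<in> D_tilde"
      using momentum_G_less_max[of w m] wm unfolding D_tilde_eq by simp
  qed
  show "D_tilde \<subseteq> G_map ` Omega"
  proof
    fix y assume "y \<in> D_tilde"
    then obtain c P where y: "y = (c, P)" and c: "0 < c" and P: "0 < P" "P < momentum_max c"
      unfolding D_tilde_eq by auto
    define h where "h = (\<lambda>m. momentum_G (level_w c m) m)"
    obtain m1 where m1: "0 < m1" "m1 < 1" "mass_G 0 m1 = c" using ex_mass_G_0[OF c] by metis
    have lt: "mass_G 0 m < c" if "0 \<le> m" "m < m1" for m
      using mass_G_strict_mono_m[of 0 m m1] that m1 by simp
    obtain w0 where w0: "0 < w0" "mass_G w0 0 = c" using ex_mass_G[of 0 c] lt[of 0] m1 by auto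
    \<comment> \<open>This expression bounds \<open>momentum_G d m\<close> for all \<open>m\<close>
      in \<open>[0, m1]\<close>, so a small \<open>d\<close> forces momentum below \<open>P\<close>
      without any limit of \<open>level_w\<close> at \<open>m1\<close>.\<close>
    have "((\<lambda>d. 2 * sqrt (d * (d + 1) * (d + 1)) * ellK m1) \<longlongrightarrow> 2 * sqrt (0 * (0 + 1) * (0 + 1)) * ellK m1) (at_right 0)"
      by (intro tendsto_intros)
    then have "eventually (\<lambda>d. 2 * sqrt (d * (d + 1) * (d + 1)) * ellK m1 < P) (at_right 0)"
      using P(1) order_tendstoD(2) by fastforce
    moreover have "eventually (\<lambda>d. 0 < d \<and> d < w0) (at_right 0)"
      using w0 by (auto simp: eventually_at_right)
    ultimately have "eventually (\<lambda>d. 2 * sqrt (d * (d + 1) * (d + 1)) * ellK m1 < P \<and> 0 < d \<and> d < w0) (at_right (0::real))"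
      by eventually_elim auto
    then obtain d where d: "2 * sqrt (d * (d + 1) * (d + 1)) * ellK m1 < P" "0 < d" "d < w0"
      using eventually_happens[of _ "at_right (0::real)"] by force
    \<comment> \<open>The level curve crosses the line \<open>w = d\<close>: along it the mass
      passes from below \<open>c\<close> to above \<open>c\<close> between 0 and
      \<open>m1\<close>.\<close>
    have "mass_G d 0 \<le> c" "c \<le> mass_G d m1"
      using mass_G_strict_mono_w[of d w0 0] mass_G_strict_mono_w[of 0 d m1] d w0 m1 by auto
    moreover have "continuous_on {0..m1} (mass_G d)"
      using d m1 by (auto intro!: continuous_at_imp_continuous_on isCont_mass_G)
    ultimately obtain mb where mb: "0 \<le> mb" "mb \<le> m1" "mass_G d mb = c"
      using IVT'[of "mass_G d" 0 c m1] m1 by auto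
    have "mb \<noteq> 0" using mb mass_G_strict_mono_w[of d w0 0] d w0 by auto
    moreover have "mb \<noteq> m1" using mb mass_G_strict_mono_w[of 0 d m1] d m1 by auto
    ultimately have mb': "0 < mb" "mb < m1" using mb by auto
    have "h mb = momentum_G d mb" unfolding h_def using level_w_eq[of d mb] mb mb' d m1 by simp
    also have "\<dots> \<le> 2 * sqrt (d * (d + 1) * (d + mb)) * ellK mb"
    proof -
      have "0 \<le> 2 * sqrt (d * (d + 1) * (d + mb)) * ellK mb" using d mb m1 ellK_ge_1[of mb] by simp
      then show ?thesis unfolding momentum_G_def using d mb
        frac_le[of "2 * sqrt (d * (d + 1) * (d + mb)) * ellK mb" _ 1 "3 * d + 1 + mb"] by simp
    qed
    also have "\<dots> \<le> 2 * sqrt (d * (d + 1) * (d + 1)) * ellK m1"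
      using d mb m1 ellK_mono[of mb m1] ellK_ge_1[of mb]
      by (intro mult_mono mult_left_mono real_sqrt_le_mono) auto
    also have "\<dots> < P" by (rule d)
    finally have hb: "h mb < P" .
    have "eventually (\<lambda>m. P < h m) (at_right 0)"
      using tendsto_momentum_level[OF c] P(2) order_tendstoD(1) unfolding h_def by blast
    moreover have "eventually (\<lambda>m. 0 < m \<and> m < mb) (at_right 0)"
      using mb' by (auto simp: eventually_at_right)
    ultimately have "eventually (\<lambda>m. P < h m \<and> 0 < m \<and> m < mb) (at_right 0)"
      by eventually_elim auto
    then obtain ma where ma: "P < h ma" "0 < ma" "ma < mb"
      using eventually_happens[of _ "at_right (0::real)"] by force
    have "continuous_on {ma..mb} h"
    proof (rule continuous_at_imp_continuous_on, rule ballI)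
      fix x assume "x \<in> {ma..mb}"
      then have "0 < x" "x < 1" "mass_G 0 x < c" using ma mb' m1 lt by auto
      then show "isCont h x"
        using momentum_level_has_derivative_neg[of x c] DERIV_isCont unfolding h_def by metis
    qed
    then obtain m where m: "ma \<le> m" "m \<le> mb" "h m = P"
      using IVT2'[of h mb P ma] ma hb by auto
    then have "0 < m" "m < 1" "mass_G 0 m < c" using ma mb' m1 lt by auto
    then have "(level_w c m, m) \<in> Omega" "G_map (level_w c m, m) = y"
      using level_w[of m c] m y unfolding Omega_def G_map_def h_def by auto
    then show "y \<in> G_map ` Omega" by force
  qed
qed

lemma diffeomorphism_on_G_map: "diffeomorphism_on Omega D_tilde G_map"
proof (rule diffeomorphism_on_if_jacobian_nonzero[OF open_Omega inj_on_G_map G_map_image smooth_on_G_map])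
  fix p assume "p \<in> Omega"
  then have O: "0 < fst p" "0 < snd p" "snd p < 1" unfolding Omega_def by (auto simp: mem_Times_iff)
  show "((\<lambda>p. fst (G_map p)) has_derivative (\<lambda>h. fst h * mass_G_dw (fst p) (snd p) + snd h * mass_G_dm (fst p) (snd p))) (at p)"
    using mass_G_has_derivative[of "fst p" "snd p"] O unfolding G_map_def by simp
  show "((\<lambda>p. snd (G_map p)) has_derivative (\<lambda>h. fst h * momentum_G_dw (fst p) (snd p) + snd h * momentum_G_dm (fst p) (snd p))) (at p)"
    using momentum_G_has_derivative[of "fst p" "snd p"] O unfolding G_map_def by simp
  show "mass_G_dw (fst p) (snd p) * momentum_G_dm (fst p) (snd p) - mass_G_dm (fst p) (snd p) * momentum_G_dw (fst p) (snd p) \<noteq> 0"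
    using jacobian_G_pos[OF O] by simp
qed

section \<open>Roots of the potential\<close>

text \<open>The pairs \<open>(s\<^sub>1, s\<^sub>2)\<close> of the two smaller roots; the third is \<open>2 - s\<^sub>1 - s\<^sub>2\<close>.\<close>

definition Sigma_dom :: "(real \<times> real) set" where
  "Sigma_dom = {p. 0 < fst p \<and> fst p < snd p \<and> snd p < 2 - fst p - snd p}"

text \<open>Vieta's formulas: the product of the roots is \<open>2 J^2\<close> and their second
  elementary symmetric function is \<open>4 E\<close>.\<close>

definition Phi_map :: "real \<times> real \<Rightarrow> real \<times> real" where
  "Phi_map p = (sqrt (fst p * snd p * (2 - fst p - snd p) / 2),
     (fst p * snd p + (fst p + snd p) * (2 - fst p - snd p)) / 4)"

lemma open_Sigma_dom: "open Sigma_dom"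
  unfolding Sigma_dom_def by (intro open_Collect_conj open_Collect_less continuous_intros)

lemma cubic_eq_potential:
  fixes J E r :: real
  assumes "r \<noteq> 0"
  shows "4 * r^2 * (E - VJ J r) = (r^2)^3 - 2 * (r^2)^2 + 4 * E * r^2 - 2 * J^2"
  using assms unfolding VJ_def by (simp add: field_simps power2_eq_square power4_eq_xxxx power3_eq_cube)

lemma Phi_map_cubic:
  assumes "p \<in> Sigma_dom" "Phi_map p = (J, E)"
  shows "s^3 - 2 * s^2 + 4 * E * s - 2 * J^2 = (s - fst p) * (s - snd p) * (s - (2 - fst p - snd p))"
proof -
  have "J = sqrt (fst p * snd p * (2 - fst p - snd p) / 2)"
    and E: "4 * E = fst p * snd p + (fst p + snd p) * (2 - fst p - snd p)"
    using assms(2) unfolding Phi_map_def by auto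
  then have J: "2 * J^2 = fst p * snd p * (2 - fst p - snd p)"
    using assms(1) unfolding Sigma_dom_def by simp
  show ?thesis unfolding E J by (simp add: algebra_simps power2_eq_square power3_eq_cube)
qed

lemma potential_factorization:
  assumes "p \<in> Sigma_dom" "Phi_map p = (J, E)" "r \<noteq> 0"
  shows "4 * r^2 * (E - VJ J r) = (r^2 - fst p) * (r^2 - snd p) * (r^2 - (2 - fst p - snd p))"
  unfolding cubic_eq_potential[OF assms(3)] Phi_map_cubic[OF assms(1,2)] ..

lemma pos_roots_Phi_map:
  assumes "p \<in> Sigma_dom" "Phi_map p = (J, E)"
  shows "pos_roots J E = [sqrt (fst p), sqrt (snd p), sqrt (2 - fst p - snd p)]"
proof -
  have p: "0 < fst p" "fst p < snd p" "snd p < 2 - fst p - snd p" using assms(1) unfolding Sigma_dom_def by auto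
  have "{r. 0 < r \<and> E - VJ J r = 0} = set [sqrt (fst p), sqrt (snd p), sqrt (2 - fst p - snd p)]"
  proof (intro set_eqI iffI)
    fix r assume "r \<in> {r. 0 < r \<and> E - VJ J r = 0}"
    then have r: "0 < r" "E - VJ J r = 0" by auto
    then have "(r^2 - fst p) * (r^2 - snd p) * (r^2 - (2 - fst p - snd p)) = 0"
      using potential_factorization[OF assms, of r] by simp
    then have "r^2 = fst p \<or> r^2 = snd p \<or> r^2 = 2 - fst p - snd p" by auto
    moreover have "sqrt (r^2) = r" using r(1) by simp
    ultimately have "r = sqrt (fst p) \<or> r = sqrt (snd p) \<or> r = sqrt (2 - fst p - snd p)" by metis
    then show "r \<in> set [sqrt (fst p), sqrt (snd p), sqrt (2 - fst p - snd p)]" by simp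
  next
    fix r assume "r \<in> set [sqrt (fst p), sqrt (snd p), sqrt (2 - fst p - snd p)]"
    then have r: "0 < r" "r^2 = fst p \<or> r^2 = snd p \<or> r^2 = 2 - fst p - snd p" using p by auto
    then have "4 * r^2 * (E - VJ J r) = 0" using potential_factorization[OF assms, of r] by auto
    then show "r \<in> {r. 0 < r \<and> E - VJ J r = 0}" using r(1) by simp
  qed
  then show ?thesis unfolding pos_roots_def
    by (simp only:) (rule sorted_list_of_set.idem_if_sorted_distinct, use p in auto)
qed

lemma r1_r2_Phi_map:
  assumes "p \<in> Sigma_dom" "Phi_map p = (J, E)"
  shows "r1 J E = sqrt (fst p)" "r2 J E = sqrt (snd p)"
  unfolding r1_def r2_def pos_roots_Phi_map[OF assms] by simp_all

text \<open>The turning points \<open>r1\<close> and \<open>r2\<close> depend on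
  \<open>(J, E)\<close> alone and return the two smaller roots.\<close>

lemma inj_on_Phi_map: "inj_on Phi_map Sigma_dom"
proof (rule inj_onI)
  fix p q assume pq: "p \<in> Sigma_dom" "q \<in> Sigma_dom" "Phi_map p = Phi_map q"
  obtain J E where "Phi_map p = (J, E)" by fastforce
  then have "sqrt (fst p) = sqrt (fst q)" "sqrt (snd p) = sqrt (snd q)"
    using r1_r2_Phi_map[of p J E] r1_r2_Phi_map[of q J E] pq by auto
  then show "p = q" by (simp add: prod_eq_iff)
qed

section \<open>Critical radii and the shape of \<open>D1\<close>\<close>

lemma inverse_sqrt_3_sq: "(1 / sqrt 3)^2 = (1/3 :: real)" "(0::real) < 1 / sqrt 3"
  by (simp_all add: power_divide)

text \<open>The difference of the two sides factors as
  \<open>(x - y) (1 - (x^2 + x y + y^2))\<close>. Below \<open>1 / sqrt 3\<close> the quadratic form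
  is less than 1, above it is greater, which makes \<open>small_q\<close> and \<open>big_Q\<close>
  well defined.\<close>

lemma cubic_J_inj:
  fixes x y :: real
  assumes "x * (1 - x^2) = y * (1 - y^2)" and "x^2 + x * y + y^2 \<noteq> 1"
  shows "x = y"
proof -
  have "(x - y) * (1 - (x^2 + x * y + y^2)) = 0"
    using assms(1) by (simp add: algebra_simps power2_eq_square)
  then show ?thesis using assms(2) by auto
qed

lemma Jmax_eq: "Jmax = 1 / sqrt 3 * (1 - (1 / sqrt 3)^2)"
proof -
  have "Jmax = sqrt ((2/3)^2 * (1/3))" unfolding Jmax_def by (simp add: power_divide)
  also have "\<dots> = 2/3 * (1 / sqrt 3)" by (simp only: real_sqrt_mult real_sqrt_abs real_sqrt_divide) simp
  finally show ?thesis unfolding inverse_sqrt_3_sq by simp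
qed

lemma small_q:
  assumes "0 < J" "J < Jmax"
  shows "0 < small_q J" "(small_q J)^2 < 1/3" "J = small_q J * (1 - (small_q J)^2)"
proof -
  have "continuous_on {0..1 / sqrt 3} (\<lambda>x::real. x * (1 - x^2))" by (intro continuous_intros)
  then obtain q where q: "0 \<le> q" "q \<le> 1 / sqrt 3" "q * (1 - q^2) = J"
    using IVT'[of "\<lambda>x. x * (1 - x^2)" 0 J "1 / sqrt 3"] assms inverse_sqrt_3_sq unfolding Jmax_eq by auto
  have "q \<noteq> 0" "q \<noteq> 1 / sqrt 3" using q assms unfolding Jmax_eq by auto
  then have q': "0 < q \<and> q < 1 / sqrt 3 \<and> J = q * (1 - q^2)" using q by auto
  have lt: "x * y < 1/3" if "0 < x" "x < 1 / sqrt 3" "0 < y" "y < 1 / sqrt 3" for x y :: real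
    using mult_strict_mono[of x "1 / sqrt 3" y "1 / sqrt 3"] that inverse_sqrt_3_sq
    by (simp add: power2_eq_square)
  have "0 < small_q J \<and> small_q J < 1 / sqrt 3 \<and> J = small_q J * (1 - (small_q J)^2)"
    unfolding small_q_def
  proof (rule theI[where a=q])
    fix y assume y: "0 < y \<and> y < 1 / sqrt 3 \<and> J = y * (1 - y^2)"
    have "y^2 + y * q + q^2 < 1"
      using lt[of y y] lt[of y q] lt[of q q] y q' unfolding power2_eq_square by linarith
    then show "y = q" using cubic_J_inj[of y q] y q' by auto
  qed (rule q')
  then show "0 < small_q J" "(small_q J)^2 < 1/3" "J = small_q J * (1 - (small_q J)^2)"
    using lt[of "small_q J" "small_q J"] by (auto simp: power2_eq_square)
qed

lemma big_Q:
  assumes "0 < J" "J < Jmax"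
  shows "0 < big_Q J" "1/3 < (big_Q J)^2" "(big_Q J)^2 < 1" "J = big_Q J * (1 - (big_Q J)^2)"
proof -
  have s1: "1 / sqrt 3 < (1::real)" by simp
  have "continuous_on {1 / sqrt 3..1} (\<lambda>x::real. x * (1 - x^2))" by (intro continuous_intros)
  then obtain q where q: "1 / sqrt 3 \<le> q" "q \<le> 1" "q * (1 - q^2) = J"
    using IVT2'[of "\<lambda>x. x * (1 - x^2)" 1 J "1 / sqrt 3"] assms s1 unfolding Jmax_eq by auto
  have "q \<noteq> 1" "q \<noteq> 1 / sqrt 3" using q assms unfolding Jmax_eq by auto
  then have q': "1 / sqrt 3 < q \<and> q < 1 \<and> J = q * (1 - q^2)" using q by auto
  have gt: "1/3 < x * y" if "1 / sqrt 3 < x" "1 / sqrt 3 < y" for x y :: real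
    using mult_strict_mono[of "1 / sqrt 3" x "1 / sqrt 3" y] that inverse_sqrt_3_sq
    by (simp add: power2_eq_square)
  have *: "1 / sqrt 3 < big_Q J \<and> big_Q J < 1 \<and> J = big_Q J * (1 - (big_Q J)^2)"
    unfolding big_Q_def
  proof (rule theI[where a=q])
    fix y assume y: "1 / sqrt 3 < y \<and> y < 1 \<and> J = y * (1 - y^2)"
    have "y^2 + y * q + q^2 > 1"
      using gt[of y y] gt[of y q] gt[of q q] y q' unfolding power2_eq_square by linarith
    then show "y = q" using cubic_J_inj[of y q] y q' by auto
  qed (rule q')
  then show pos: "0 < big_Q J" using inverse_sqrt_3_sq(2) by linarith
  show "(big_Q J)^2 < 1" using * pos by (simp add: abs_square_less_1)
  show "1/3 < (big_Q J)^2" "J = big_Q J * (1 - (big_Q J)^2)"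
    using * gt[of "big_Q J" "big_Q J"] by (auto simp: power2_eq_square)
qed

text \<open>The critical values: \<open>\<sigma> = 1 - Q\<^sup>2\<close> and \<open>\<tau> = 1 - q\<^sup>2\<close> are the squares of the critical radii of
  \<open>VJ J\<close>, at which the potential takes the values \<open>E_minus J\<close> and \<open>E_plus J\<close>.\<close>

lemma critical_points:
  assumes "0 < J" "J < Jmax"
  obtains \<sigma> \<tau> where "0 < \<sigma>" "\<sigma> < 2/3" "2/3 < \<tau>" "\<tau> < 1"
    "J^2 = \<sigma>^2 * (1 - \<sigma>)" "J^2 = \<tau>^2 * (1 - \<tau>)"
    "4 * E_minus J = \<sigma> * (4 - 3 * \<sigma>)" "4 * E_plus J = \<tau> * (4 - 3 * \<tau>)"
proof (rule that[of "1 - (big_Q J)^2" "1 - (small_q J)^2"])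
  note Q = big_Q[OF assms] and q = small_q[OF assms]
  show "J^2 = (1 - (big_Q J)^2)^2 * (1 - (1 - (big_Q J)^2))"
    by (subst Q(4)) (simp add: power_mult_distrib)
  show "J^2 = (1 - (small_q J)^2)^2 * (1 - (1 - (small_q J)^2))"
    by (subst q(3)) (simp add: power_mult_distrib)
qed (use small_q[OF assms] big_Q[OF assms] in \<open>auto simp: E_minus_def E_plus_def\<close>)

text \<open>At the energy with \<open>4 E = \<sigma> (4 - 3 \<sigma>)\<close> the cubic has the
  double root \<open>\<sigma>\<close> and hence the third root \<open>2 - 2 \<sigma>\<close>.
  Another energy changes it by a multiple of \<open>s\<close>, so the sign of the right side at a
  root compares E with the critical value.\<close>

lemma cubic_at_critical:
  fixes s \<sigma> E J :: real
  assumes "J^2 = \<sigma>^2 * (1 - \<sigma>)" "s^3 - 2 * s^2 + 4 * E * s - 2 * J^2 = 0"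
  shows "s * (4 * E - \<sigma> * (4 - 3 * \<sigma>)) = (s - \<sigma>)^2 * (2 - 2 * \<sigma> - s)"
proof -
  have "4 * E * s = 2 * (\<sigma>^2 * (1 - \<sigma>)) + 2 * s^2 - s^3" using assms by simp
  then show ?thesis by (simp add: algebra_simps power2_eq_square power3_eq_cube)
qed

lemma Phi_map_in_D1:
  assumes "p \<in> Sigma_dom" shows "Phi_map p \<in> D1"
proof -
  obtain J E where JE: "Phi_map p = (J, E)" by fastforce
  define s1 s2 s3 where "s1 = fst p" and "s2 = snd p" and "s3 = 2 - fst p - snd p"
  have s: "0 < s1" "s1 < s2" "s2 < s3" "s1 + s2 + s3 = 2"
    using assms unfolding Sigma_dom_def s1_def s2_def s3_def by auto
  have Jd: "J = sqrt (s1 * s2 * s3 / 2)" using JE unfolding Phi_map_def s1_def s2_def s3_def by auto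
  have J0: "0 < J" unfolding Jd using s by simp
  \<comment> \<open>The strict inequality of arithmetic and geometric means for sum 2, with the gap
    made explicit in the differences \<open>x\<close> and \<open>y\<close>.\<close>
  have "s1 * s2 * s3 < 8/27"
  proof -
    define x y where "x = s2 - s1" and "y = s3 - s2"
    have xy: "x > 0" "y > 0" "s2 = s1 + x" "s3 = s1 + x + y" using s unfolding x_def y_def by auto
    have "27 * (s1 * s2 * s3) = (s1 + s2 + s3)^3 - (9 * s1 * (x^2 + x * y + y^2) + (2 * x + y)^3)"
      unfolding xy(3,4) by (simp add: algebra_simps power2_eq_square power3_eq_cube)
    moreover have "0 < 9 * s1 * (x^2 + x * y + y^2) + (2 * x + y)^3"
      using xy s by (intro add_pos_pos mult_pos_pos) auto
    ultimately show ?thesis unfolding s(4) by simp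
  qed
  then have J1: "J < Jmax" unfolding Jd Jmax_def by simp
  have root: "t^3 - 2 * t^2 + 4 * E * t - 2 * J^2 = 0" if "t \<in> {s1, s2, s3}" for t
    using that Phi_map_cubic[OF assms JE, of t] unfolding s1_def s2_def s3_def by auto
  obtain \<sigma> \<tau> where st: "0 < \<sigma>" "\<sigma> < 2/3" "2/3 < \<tau>" "\<tau> < 1"
    "J^2 = \<sigma>^2 * (1 - \<sigma>)" "J^2 = \<tau>^2 * (1 - \<tau>)"
    "4 * E_minus J = \<sigma> * (4 - 3 * \<sigma>)" "4 * E_plus J = \<tau> * (4 - 3 * \<tau>)"
    using critical_points[OF J0 J1] by metis
  \<comment> \<open>At a critical energy every root would be \<open>u\<close> or
    \<open>2 - 2 * u\<close>, too few values for three distinct roots.\<close>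
  have ne: "4 * E \<noteq> u * (4 - 3 * u)" if "J^2 = u^2 * (1 - u)" for u
  proof
    assume e: "4 * E = u * (4 - 3 * u)"
    have "t = u \<or> t = 2 - 2 * u" if "t \<in> {s1, s2, s3}" for t
      using cubic_at_critical[OF \<open>J^2 = u^2 * (1 - u)\<close> root[OF that]] e by auto
    from this[of s1] this[of s2] this[of s3] show False using s by auto
  qed
  \<comment> \<open>The smallest root lies below the mean 2/3 and the largest above it. With
    \<open>\<sigma> < 2/3 < \<tau>\<close> this fixes the sign of the last factor, here and at
    \<open>s3\<close> below.\<close>
  have "0 \<le> (s1 - \<sigma>)^2 * (2 - 2 * \<sigma> - s1)" using s st by (intro mult_nonneg_nonneg) auto
  then have "0 \<le> s1 * (4 * E - \<sigma> * (4 - 3 * \<sigma>))" using cubic_at_critical[OF st(5) root[of s1]] by simp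
  then have "E_minus J < E" using s(1) ne[OF st(5)] st(7) by (simp add: zero_le_mult_iff)
  moreover have "(s3 - \<tau>)^2 * (2 - 2 * \<tau> - s3) \<le> 0" using s st by (intro mult_nonneg_nonpos) auto
  then have "s3 * (4 * E - \<tau> * (4 - 3 * \<tau>)) \<le> 0" using cubic_at_critical[OF st(6) root[of s3]] by simp
  then have "E < E_plus J" using s ne[OF st(6)] st(8) by (simp add: mult_le_0_iff)
  ultimately show ?thesis using J0 J1 unfolding JE D1_def by simp
qed

text \<open>The cubic changes sign between 0, \<open>\<sigma>\<close>, \<open>\<tau>\<close> and 2:
  the bounds \<open>E_minus J < E < E_plus J\<close> say exactly that it is positive at
  \<open>\<sigma>\<close> and negative at \<open>\<tau>\<close>.\<close>

lemma D1_subset_Phi_map: "D1 \<subseteq> Phi_map ` Sigma_dom"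
proof
  fix y assume "y \<in> D1"
  then obtain J E where y: "y = (J, E)" and JE: "0 < J" "J < Jmax" "E_minus J < E" "E < E_plus J"
    unfolding D1_def by auto
  define f where "f = (\<lambda>s. s^3 - 2 * s^2 + 4 * E * s - 2 * J^2)"
  obtain \<sigma> \<tau> where st: "0 < \<sigma>" "\<sigma> < 2/3" "2/3 < \<tau>" "\<tau> < 1"
    "J^2 = \<sigma>^2 * (1 - \<sigma>)" "J^2 = \<tau>^2 * (1 - \<tau>)"
    "4 * E_minus J = \<sigma> * (4 - 3 * \<sigma>)" "4 * E_plus J = \<tau> * (4 - 3 * \<tau>)"
    using critical_points[OF JE(1,2)] by metis
  have fc: "f u = u * (4 * E - u * (4 - 3 * u))" if "J^2 = u^2 * (1 - u)" for u
    unfolding f_def that by (simp add: algebra_simps power2_eq_square power3_eq_cube)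
  have "f 0 < 0" using JE(1) unfolding f_def by simp
  moreover have "0 < f \<sigma>" unfolding fc[OF st(5)] using st JE by simp
  moreover have "f \<tau> < 0" unfolding fc[OF st(6)] using st JE by (intro mult_pos_neg) auto
  \<comment> \<open>Here \<open>f 2 = 8 E - 2 J^2\<close>, so the claim is \<open>J^2 < 4 E\<close>;
    already \<open>4 * E_minus J\<close> is at least \<open>J^2\<close>.\<close>
  moreover have "0 < f 2"
  proof -
    have "\<sigma> * (\<sigma> * (1 - \<sigma>)) \<le> \<sigma> * (4 - 3 * \<sigma>)"
    proof (rule mult_left_mono)
      have "\<sigma> * (1 - \<sigma>) \<le> 1 * 1" using st by (intro mult_mono) auto
      then show "\<sigma> * (1 - \<sigma>) \<le> 4 - 3 * \<sigma>" using st by simp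
    qed (use st in simp)
    then have "J^2 \<le> 4 * E_minus J" unfolding st(5,7) by (simp add: power2_eq_square mult.assoc)
    then have "J^2 < 4 * E" using JE by simp
    then show ?thesis using zero_le_power2[of J] unfolding f_def by simp
  qed
  moreover have cont: "continuous_on A f" for A unfolding f_def by (intro continuous_intros)
  ultimately obtain s1 s2 s3 where s: "0 \<le> s1" "s1 \<le> \<sigma>" "f s1 = 0" "\<sigma> \<le> s2" "s2 \<le> \<tau>" "f s2 = 0"
      "\<tau> \<le> s3" "f s3 = 0"
    using IVT'[of f 0 0 \<sigma>] IVT2'[of f \<tau> 0 \<sigma>] IVT'[of f \<tau> 0 2] st by auto
  then have "s1 \<noteq> 0" "s1 \<noteq> \<sigma>" "s2 \<noteq> \<sigma>" "s2 \<noteq> \<tau>" "s3 \<noteq> \<tau>"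
    using \<open>f 0 < 0\<close> \<open>0 < f \<sigma>\<close> \<open>f \<tau> < 0\<close> by auto
  then have o: "0 < s1" "s1 < s2" "s2 < s3" using s by auto
  \<comment> \<open>The divided difference of \<open>f\<close> at two roots. Subtracting its
    instances for \<open>s1, s2\<close> and \<open>s1, s3\<close> gives the sum 2 of the
    roots.\<close>
  have d: "u^2 + u * v + v^2 - 2 * (u + v) + 4 * E = 0" if "f u = 0" "f v = 0" "u \<noteq> v" for u v
  proof -
    have "(u - v) * (u^2 + u * v + v^2 - 2 * (u + v) + 4 * E) = f u - f v"
      unfolding f_def by (simp add: algebra_simps power2_eq_square power3_eq_cube)
    then show ?thesis using that by simp
  qed
  have "(s2 - s3) * (s1 + s2 + s3 - 2) = 0"
    using d[OF s(3,6)] d[OF s(3,8)] o by (simp add: algebra_simps power2_eq_square)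
  then have s3: "s3 = 2 - s1 - s2" using o by simp
  have E: "4 * E = s1 * s2 + (s1 + s2) * s3"
    using d[OF s(3,6)] o unfolding s3 by (simp add: algebra_simps power2_eq_square)
  have J: "2 * J^2 = s1 * s2 * s3"
  proof -
    have "2 * J^2 = s1^3 - 2 * s1^2 + (4 * E) * s1" using s(3) unfolding f_def by simp
    also have "\<dots> = s1 * s2 * s3" unfolding E s3 by (simp add: algebra_simps power2_eq_square power3_eq_cube)
    finally show ?thesis .
  qed
  have "J = sqrt (s1 * s2 * s3 / 2)" using JE(1) J[symmetric] by simp
  then have "Phi_map (s1, s2) = y" using E unfolding y Phi_map_def s3 by simp
  moreover have "(s1, s2) \<in> Sigma_dom" using o s3 unfolding Sigma_dom_def by simp
  ultimately show "y \<in> Phi_map ` Sigma_dom" by (metis imageI)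
qed

text \<open>The Jacobian is the product of the three root differences divided by
  \<open>16 J\<close>, so it is nonzero because the roots are distinct.\<close>

lemma diffeomorphism_on_Phi_map: "diffeomorphism_on Sigma_dom D1 Phi_map"
proof (rule diffeomorphism_on_if_jacobian_nonzero[OF open_Sigma_dom inj_on_Phi_map])
  show "Phi_map ` Sigma_dom = D1" using Phi_map_in_D1 D1_subset_Phi_map by blast
  have pos: "0 < fst p * snd p * (2 - fst p - snd p) / 2" if "p \<in> Sigma_dom" for p
    using that unfolding Sigma_dom_def by auto
  note rules = Ck_on_divide Ck_on_mult Ck_on_const Ck_on_diff Ck_on_add Ck_on_sqrt Ck_on_fst Ck_on_snd
  have "Ck_on k Sigma_dom (\<lambda>p. fst (Phi_map p))" "Ck_on k Sigma_dom (\<lambda>p. snd (Phi_map p))" for k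
    unfolding Phi_map_def fst_conv snd_conv by (rule rules | use pos in force)+
  then show "smooth_on Sigma_dom Phi_map" unfolding smooth_on_def by blast
  fix p assume p: "p \<in> Sigma_dom"
  define J where "J = fst (Phi_map p)"
  have J: "0 < J" using pos[OF p] unfolding J_def Phi_map_def by simp
  show "((\<lambda>p. fst (Phi_map p)) has_derivative (\<lambda>h. fst h * (snd p * (2 - 2 * fst p - snd p) / (4 * fst (Phi_map p)))
      + snd h * (fst p * (2 - fst p - 2 * snd p) / (4 * fst (Phi_map p))))) (at p)"
  proof -
    have d: "((\<lambda>p. fst p * snd p * (2 - fst p - snd p) / 2) has_derivative
        (\<lambda>h. (fst h * (snd p * (2 - 2 * fst p - snd p)) + snd h * (fst p * (2 - fst p - 2 * snd p))) / 2)) (at p)"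
      by (auto intro!: derivative_eq_intros simp: fun_eq_iff field_simps)
    have Js: "sqrt (fst p * snd p * (2 - fst p - snd p) / 2) = J" unfolding J_def Phi_map_def by simp
    have F: "(\<lambda>p. fst (Phi_map p)) = (\<lambda>p. sqrt (fst p * snd p * (2 - fst p - snd p) / 2))"
      unfolding Phi_map_def by simp
    show ?thesis unfolding F J_def[symmetric]
      by (rule has_derivative_eq_rhs[OF has_derivative_real_sqrt[OF pos[OF p] d, unfolded Js]])
        (use J in \<open>simp add: fun_eq_iff field_simps\<close>)
  qed
  show "((\<lambda>p. snd (Phi_map p)) has_derivative (\<lambda>h. fst h * ((2 - 2 * fst p - snd p) / 4)
      + snd h * ((2 - fst p - 2 * snd p) / 4))) (at p)"
    unfolding Phi_map_def snd_conv by (auto intro!: derivative_eq_intros simp: field_simps)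
  have "snd p * (2 - 2 * fst p - snd p) / (4 * fst (Phi_map p)) * ((2 - fst p - 2 * snd p) / 4)
      - fst p * (2 - fst p - 2 * snd p) / (4 * fst (Phi_map p)) * ((2 - 2 * fst p - snd p) / 4)
      = (snd p - fst p) * (2 - 2 * fst p - snd p) * (2 - fst p - 2 * snd p) / (16 * J)"
    unfolding J_def[symmetric] using J by (simp add: field_simps)
  also have "\<dots> \<noteq> 0" using p J unfolding Sigma_dom_def by auto
  finally show "snd p * (2 - 2 * fst p - snd p) / (4 * fst (Phi_map p)) * ((2 - fst p - 2 * snd p) / 4)
      - fst p * (2 - fst p - 2 * snd p) / (4 * fst (Phi_map p)) * ((2 - 2 * fst p - snd p) / 4) \<noteq> 0" .
qed

definition R_map :: "real \<times> real \<Rightarrow> real \<times> real" where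
  "R_map p = (2 * fst p / (3 * fst p + 1 + snd p), 2 * (fst p + snd p) / (3 * fst p + 1 + snd p))"

lemma diffeomorphism_on_R_map: "diffeomorphism_on Omega Sigma_dom R_map"
proof -
  \<comment> \<open>The denominator is \<open>s3 - s1\<close>, rewritten with
    \<open>s3 = 2 - s1 - s2\<close>.\<close>
  let ?g = "\<lambda>s. (fst s / (2 - 2 * fst s - snd s), (snd s - fst s) / (2 - 2 * fst s - snd s)) :: real \<times> real"
  note rules = Ck_on_divide Ck_on_mult Ck_on_const Ck_on_diff Ck_on_add Ck_on_fst Ck_on_snd
  have O: "0 < fst p" "0 < snd p" "snd p < 1" "0 < 3 * fst p + 1 + snd p" if "p \<in> Omega" for p
    using that unfolding Omega_def by (auto simp: mem_Times_iff)
  have S: "0 < fst s" "fst s < snd s" "snd s < 2 - fst s - snd s" "0 < 2 - 2 * fst s - snd s" if "s \<in> Sigma_dom" for s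
    using that unfolding Sigma_dom_def by auto
  show ?thesis
  proof (rule diffeomorphism_onI[OF open_Sigma_dom, where g="?g"])
    show "R_map ` Omega \<subseteq> Sigma_dom"
    proof (rule image_subsetI)
      fix p assume "p \<in> Omega"
      note p = O[OF this]
      define D where "D = 3 * fst p + 1 + snd p"
      have D: "D > 0" using p unfolding D_def by simp
      have "2 - 2 * fst p / D - 2 * (fst p + snd p) / D = (2 * D - 2 * fst p - 2 * (fst p + snd p)) / D"
        using D by (simp only: diff_divide_distrib) simp
      also have "2 * D - 2 * fst p - 2 * (fst p + snd p) = 2 * (fst p + 1)" by (simp add: D_def)
      finally have e: "2 - 2 * fst p / D - 2 * (fst p + snd p) / D = 2 * (fst p + 1) / D" .
      moreover have "0 < 2 * fst p / D" "2 * (fst p + snd p) / D < 2 * (fst p + 1) / D" "2 * fst p / D < 2 * (fst p + snd p) / D"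
        using p D by (auto intro!: divide_strict_right_mono)
      ultimately show "R_map p \<in> Sigma_dom"
        unfolding R_map_def Sigma_dom_def D_def[symmetric] mem_Collect_eq fst_conv snd_conv e by blast
    qed
    show "?g ` Sigma_dom \<subseteq> Omega"
    proof (rule image_subsetI)
      fix s assume "s \<in> Sigma_dom"
      note s = S[OF this]
      then show "?g s \<in> Omega" unfolding Omega_def by (simp add: divide_less_eq)
    qed
    have "Ck_on k Omega (\<lambda>p. fst (R_map p))" "Ck_on k Omega (\<lambda>p. snd (R_map p))" for k
      unfolding R_map_def fst_conv snd_conv by (rule rules | use O in force)+
    then show "smooth_on Omega R_map" unfolding smooth_on_def by blast
    have "Ck_on k Sigma_dom (\<lambda>p. fst (?g p))" "Ck_on k Sigma_dom (\<lambda>p. snd (?g p))" for k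
      unfolding fst_conv snd_conv by (rule rules | use S in force)+
    then show "smooth_on Sigma_dom ?g" unfolding smooth_on_def by blast
    show "?g (R_map p) = p" if "p \<in> Omega" for p
    proof -
      define D where "D = 3 * fst p + 1 + snd p"
      have D: "D \<noteq> 0" using O[OF that] unfolding D_def by simp
      have "2 - 2 * (2 * fst p / D) - 2 * (fst p + snd p) / D = (2 * D - 2 * (2 * fst p) - 2 * (fst p + snd p)) / D"
        using D by (simp only: diff_divide_distrib) simp
      also have "2 * D - 2 * (2 * fst p) - 2 * (fst p + snd p) = 2" by (simp add: D_def)
      finally have e: "2 - 2 * (2 * fst p / D) - 2 * (fst p + snd p) / D = 2 / D" .
      show ?thesis unfolding R_map_def D_def[symmetric] fst_conv snd_conv e
        using D by (simp add: prod_eq_iff field_simps)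
    qed
    show "R_map (?g s) = s" if "s \<in> Sigma_dom" for s
    proof -
      define A where "A = 2 - 2 * fst s - snd s"
      have A: "A \<noteq> 0" using S[OF that] unfolding A_def by simp
      have "3 * (fst s / A) + 1 + (snd s - fst s) / A = (3 * fst s + A + (snd s - fst s)) / A"
        using A by (simp only: add_divide_distrib) simp
      also have "3 * fst s + A + (snd s - fst s) = 2" by (simp add: A_def)
      finally have e: "3 * (fst s / A) + 1 + (snd s - fst s) / A = 2 / A" .
      show ?thesis unfolding R_map_def A_def[symmetric] fst_conv snd_conv e
        using A by (simp add: prod_eq_iff field_simps)
    qed
  qed
qed

section \<open>Reduction of the period integrals\<close>

text \<open>The substitution is \<open>r^2 = a + (b - a) sin^2 t\<close>, and
  \<open>\<theta>\<close> is its inverse, with derivative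
  \<open>r / sqrt ((r^2 - a) (b - r^2))\<close>. As that blows up at both ends, the fundamental
  theorem is used in its interior form: the antiderivative is continuous up to the ends and
  differentiated only inside.\<close>

lemma has_integral_arccos_substitution:
  fixes a b :: real and f \<phi> :: "real \<Rightarrow> real"
  defines "\<theta> \<equiv> \<lambda>r. arccos ((a + b - 2 * r^2) / (b - a)) / 2"
  assumes ab: "0 < a" "a < b" and \<phi>: "continuous_on {0..pi/2} \<phi>"
    and f: "\<And>r. sqrt a < r \<Longrightarrow> r < sqrt b \<Longrightarrow> f r = \<phi> (\<theta> r) * (r / sqrt ((r^2 - a) * (b - r^2)))"
  shows "(f has_integral integral {0..pi/2} \<phi>) {sqrt a..sqrt b}"
proof -
  define F where "F = (\<lambda>x. integral {0..x} \<phi>)"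
  define u where "u = (\<lambda>r. (a + b - 2 * r^2) / (b - a))"
  have r2: "a \<le> r^2" "r^2 \<le> b" if "r \<in> {sqrt a..sqrt b}" for r
  proof -
    have "0 \<le> sqrt a" using ab by simp
    then have "0 \<le> r" using that by (meson atLeastAtMost_iff order_trans)
    then show "a \<le> r^2" "r^2 \<le> b"
      using that ab power_mono[of "sqrt a" r 2] power_mono[of r "sqrt b" 2] by auto
  qed
  have r2': "a < r^2" "r^2 < b" "0 < r" if "sqrt a < r" "r < sqrt b" for r
  proof -
    have "0 < sqrt a" using ab by simp
    then show "0 < r" using that by linarith
    then show "a < r^2" "r^2 < b"
      using that ab power_strict_mono[of "sqrt a" r 2] power_strict_mono[of r "sqrt b" 2] by auto
  qed
  have u: "-1 \<le> u r" "u r \<le> 1" if "r \<in> {sqrt a..sqrt b}" for r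
    using r2[OF that] ab unfolding u_def by (auto simp: field_simps)
  have u': "-1 < u r" "u r < 1" if "sqrt a < r" "r < sqrt b" for r
    using r2'[OF that] ab unfolding u_def by (auto simp: field_simps)
  have "continuous_on {sqrt a..sqrt b} u" unfolding u_def using ab by (intro continuous_intros) auto
  then have "continuous_on {sqrt a..sqrt b} (\<lambda>r. arccos (u r))"
    by (rule continuous_on_arccos) (use u in blast)
  then have c\<theta>: "continuous_on {sqrt a..sqrt b} \<theta>"
    unfolding \<theta>_def u_def by (intro continuous_on_divide continuous_on_const) auto
  have \<theta>r: "\<theta> r \<in> {0..pi/2}" if "r \<in> {sqrt a..sqrt b}" for r
    using arccos_lbound[OF u[OF that]] arccos_ubound[OF u[OF that]] unfolding \<theta>_def u_def by simp
  have "continuous_on {0..pi/2} F"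
    unfolding F_def by (intro indefinite_integral_continuous_1 integrable_continuous_real \<phi>)
  then have "continuous_on {sqrt a..sqrt b} (\<lambda>r. F (\<theta> r))"
    by (rule continuous_on_compose2[OF _ c\<theta> image_subsetI]) (rule \<theta>r)
  moreover have "((\<lambda>r. F (\<theta> r)) has_vector_derivative f r) (at r)" if "r \<in> {sqrt a<..<sqrt b}" for r
  proof -
    have r: "sqrt a < r" "r < sqrt b" using that by auto
    define q where "q = sqrt ((r^2 - a) * (b - r^2))"
    have q: "q > 0" unfolding q_def using r2'[OF r] by simp
    have "1 - (u r)^2 = (2 / (b - a))^2 * ((r^2 - a) * (b - r^2))"
    proof -
      have "(b - a)^2 - (a + b - 2 * r^2)^2 = 4 * ((r^2 - a) * (b - r^2))"
        by (simp add: power2_eq_square algebra_simps)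
      moreover have "1 - (u r)^2 = ((b - a)^2 - (a + b - 2 * r^2)^2) / (b - a)^2"
        unfolding u_def power_divide diff_divide_distrib[of "(b - a)^2"] using ab by simp
      ultimately show ?thesis by (simp add: power_divide)
    qed
    then have su: "sqrt (1 - (u r)^2) = 2 / (b - a) * q"
      unfolding q_def using ab by (simp add: real_sqrt_mult)
    have du: "(u has_real_derivative (- 4 * r / (b - a))) (at r)"
      unfolding u_def by (rule DERIV_cdivide) (auto intro!: derivative_eq_intros)
    have "((\<lambda>r. arccos (u r) / 2) has_real_derivative inverse (- sqrt (1 - (u r)^2)) * (- 4 * r / (b - a)) / 2) (at r)"
      using DERIV_chain2[OF DERIV_arccos[OF u'[OF r]] du] by (rule DERIV_cdivide)
    moreover have "inverse (- sqrt (1 - (u r)^2)) * (- 4 * r / (b - a)) / 2 = r / q"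
      unfolding su using ab q by (simp add: field_simps)
    ultimately have d\<theta>: "(\<theta> has_real_derivative r / q) (at r)"
      unfolding \<theta>_def u_def by simp
    have "0 < arccos (u r)" "arccos (u r) < pi" using arccos_lt_bounded[OF u'[OF r]] by auto
    then have \<theta>i: "0 < \<theta> r" "\<theta> r < pi/2" unfolding \<theta>_def u_def by auto
    have "(F has_real_derivative \<phi> (\<theta> r)) (at (\<theta> r) within {0..pi/2})"
      unfolding F_def using \<theta>i by (intro integral_has_real_derivative \<phi>) auto
    then have "(F has_real_derivative \<phi> (\<theta> r)) (at (\<theta> r))"
      using \<theta>i by (simp add: at_within_Icc_at)
    from DERIV_chain2[OF this d\<theta>] show ?thesis
      unfolding f[OF r] q_def by (simp add: has_real_derivative_iff_has_vector_derivative)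
  qed
  ultimately have "(f has_integral (F (\<theta> (sqrt b)) - F (\<theta> (sqrt a)))) {sqrt a..sqrt b}"
    using ab by (intro fundamental_theorem_of_calculus_interior) auto
  moreover have "\<theta> (sqrt a) = 0" "\<theta> (sqrt b) = pi/2"
  proof -
    have "u (sqrt a) = 1" "u (sqrt b) = -1" unfolding u_def using ab by (auto simp: field_simps)
    then show "\<theta> (sqrt a) = 0" "\<theta> (sqrt b) = pi/2" unfolding \<theta>_def u_def by simp_all
  qed
  ultimately show ?thesis unfolding F_def by simp
qed

text \<open>The third factor of the cubic becomes \<open>c - r^2 = A * (ell_delta m t)^2\<close> at
  \<open>t = \<theta> r\<close>; the other two are absorbed by the substitution. The weight
  \<open>r^2\<close> of the mass then yields one multiple of K and one of E.\<close>

lemma Psi_Phi_R_map: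
  assumes "p \<in> Omega" shows "Psi (Phi_map (R_map p)) = G_map p"
proof -
  obtain w m where p: "p = (w, m)" by fastforce
  have wm: "0 < w" "0 < m" "m < 1" using assms unfolding p Omega_def by auto
  obtain J E where JE: "Phi_map (R_map p) = (J, E)" by fastforce
  have R: "R_map p \<in> Sigma_dom"
    using assms diffeomorphism_on_R_map unfolding diffeomorphism_on_def by blast
  define A where "A = 2 / (3 * w + 1 + m)"
  have A: "A > 0" "A * (3 * w + 1 + m) = 2" using wm unfolding A_def by (auto simp: divide_simps)
  define a b c where "a = A * w" and "b = A * (w + m)" and "c = A * (w + 1)"
  have ab: "0 < a" "a < b" "b < c" unfolding a_def b_def c_def using A wm by auto
  have Rab: "fst (R_map p) = a" "snd (R_map p) = b" "2 - fst (R_map p) - snd (R_map p) = c"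
  proof -
    show 1: "fst (R_map p) = a" "snd (R_map p) = b" unfolding R_map_def p a_def b_def A_def by auto
    show "2 - fst (R_map p) - snd (R_map p) = c"
      unfolding 1 unfolding A(2)[symmetric] a_def b_def c_def by (simp add: algebra_simps)
  qed
  note r12 = r1_r2_Phi_map[OF R JE, unfolded Rab]
  define \<theta> where "\<theta> = (\<lambda>r. arccos ((a + b - 2 * r^2) / (b - a)) / 2)"
  \<comment> \<open>\<open>k\<close> collects the constants left after the substitution; it equals
    \<open>sqrt (3 * w + 1 + m)\<close>, the denominator of \<open>mass_G\<close>.\<close>
  define k where "k = sqrt (2 / A)"
  have key: "1 / sqrt (2 * (E - VJ J r)) = k / ell_delta m (\<theta> r) * (r / sqrt ((r^2 - a) * (b - r^2)))"
    and r2: "r^2 = A * (w + 1 - (ell_delta m (\<theta> r))^2)" if r: "sqrt a < r" "r < sqrt b" for r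
  proof -
    have "0 < sqrt a" using ab by simp
    then have r0: "0 < r" using r by linarith
    have rr: "a < r^2" "r^2 < b"
      using r r0 ab power_strict_mono[of "sqrt a" r 2] power_strict_mono[of r "sqrt b" 2] by auto
    have "cos (2 * \<theta> r) = (a + b - 2 * r^2) / (b - a)"
      unfolding \<theta>_def using rr ab by (simp add: field_simps)
    then have "(sin (\<theta> r))^2 = (r^2 - a) / (b - a)"
      unfolding cos_double_sin using ab by (simp add: field_simps)
    also have "b - a = A * m" unfolding a_def b_def by (simp add: algebra_simps)
    finally have s: "m * (sin (\<theta> r))^2 = (r^2 - a) / A" using wm A by simp
    have d2: "(ell_delta m (\<theta> r))^2 = (c - r^2) / A"
      unfolding ell_delta_sq[OF wm(3)] s using A unfolding a_def c_def by (simp add: field_simps)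
    then show "r^2 = A * (w + 1 - (ell_delta m (\<theta> r))^2)"
      using A unfolding c_def by (simp add: field_simps)
    have d: "ell_delta m (\<theta> r) = sqrt ((c - r^2) / A)"
      using d2 ell_delta_pos[OF wm(3), of "\<theta> r"] by (metis less_imp_le real_sqrt_unique)
    have "4 * r^2 * (E - VJ J r) = (r^2 - a) * (r^2 - b) * (r^2 - c)"
      using potential_factorization[OF R JE, of r] r0 unfolding Rab(3) unfolding Rab(1,2) by simp
    also have "\<dots> = ((r^2 - a) * (b - r^2)) * (c - r^2)" by (simp add: algebra_simps)
    finally have f: "((r^2 - a) * (b - r^2)) * (c - r^2) = 4 * r^2 * (E - VJ J r)" by simp
    have "((r^2 - a) * (b - r^2)) * ((c - r^2) / A) / (r^2 * (2 / A))
        = (((r^2 - a) * (b - r^2)) * (c - r^2)) / (2 * r^2)" using A(1) by simp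
    also have "\<dots> = 2 * (E - VJ J r)" unfolding f using r0 by simp
    finally have e: "2 * (E - VJ J r) = ((r^2 - a) * (b - r^2)) * ((c - r^2) / A) / (r^2 * (2 / A))" by simp
    have "sqrt (2 * (E - VJ J r)) = sqrt ((r^2 - a) * (b - r^2)) * ell_delta m (\<theta> r) / (r * k)"
      unfolding e d k_def real_sqrt_divide[of "_ * _" "r^2 * (2 / A)"] real_sqrt_mult[of _ "(c - r^2) / A"]
        real_sqrt_mult[of "r^2"] using r0 by simp
    then show "1 / sqrt (2 * (E - VJ J r)) = k / ell_delta m (\<theta> r) * (r / sqrt ((r^2 - a) * (b - r^2)))"
      by (simp add: mult.commute)
  qed
  have dnz: "ell_delta m t \<noteq> 0" for t using ell_delta_pos[OF wm(3), of t] by simp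
  have "((\<lambda>r. 1 / sqrt (2 * (E - VJ J r))) has_integral integral {0..pi/2} (\<lambda>t. k * (1 / ell_delta m t))) {sqrt a..sqrt b}"
    by (rule has_integral_arccos_substitution[OF ab(1,2)])
      (use dnz key in \<open>auto intro!: continuous_intros continuous_on_ell_delta simp: \<theta>_def\<close>)
  then have T: "period_T J E = 2 * (k * ellK m)"
    unfolding period_T_def r12 ellK_def by (simp only: integral_unique integral_mult_right)
  have "((\<lambda>r. r^2 / sqrt (2 * (E - VJ J r))) has_integral
      integral {0..pi/2} (\<lambda>t. k * A * ((w + 1) * (1 / ell_delta m t) - ell_delta m t))) {sqrt a..sqrt b}"
  proof (rule has_integral_arccos_substitution[OF ab(1,2)])
    show "continuous_on {0..pi/2} (\<lambda>t. k * A * ((w + 1) * (1 / ell_delta m t) - ell_delta m t))"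
      using dnz by (intro continuous_intros continuous_on_ell_delta) auto
    fix r assume r: "sqrt a < r" "r < sqrt b"
    define d q where "d = ell_delta m (\<theta> r)" and "q = r / sqrt ((r^2 - a) * (b - r^2))"
    have "r^2 / sqrt (2 * (E - VJ J r)) = r^2 * (1 / sqrt (2 * (E - VJ J r)))" by simp
    also have "\<dots> = A * (w + 1 - d^2) * (k / d * q)"
      unfolding key[OF r] d_def q_def using r2[OF r] by simp
    also have "\<dots> = k * A * ((w + 1) * (1 / d) - d) * q"
      using dnz[of "\<theta> r"] unfolding d_def[symmetric] by (simp add: field_simps power2_eq_square)
    finally show "r^2 / sqrt (2 * (E - VJ J r)) = k * A * ((w + 1) *
        (1 / ell_delta m (arccos ((a + b - 2 * r^2) / (b - a)) / 2)) - ell_delta m (arccos ((a + b - 2 * r^2) / (b - a)) / 2)) *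
        (r / sqrt ((r^2 - a) * (b - r^2)))"
      unfolding d_def q_def \<theta>_def .
  qed
  then have "mass_M J E = integral {0..pi/2} (\<lambda>t. k * A * ((w + 1) * (1 / ell_delta m t) - ell_delta m t))"
    unfolding mass_M_def r12 by (rule integral_unique)
  also have "\<dots> = k * A * ((w + 1) * ellK m - ellE m)"
    unfolding ellK_def ellE_def
    using integral_diff[OF integrable_on_mult_right[OF ell_integrable(1)[OF wm(3)]] ell_integrable(2)[OF wm(3)]]
    by (simp only: integral_mult_right)
  finally have M: "mass_M J E = k * A * ((w + 1) * ellK m - ellE m)" .
  have kk: "k = sqrt (3 * w + 1 + m)" unfolding k_def A_def using wm by simp
  have k0: "k > 0" and "k * k = 3 * w + 1 + m" unfolding kk using wm by auto
  then have "A * (k * k) = 2" using A(2) by simp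
  then have kA: "k * A = 2 / k" using k0 by (simp add: eq_divide_eq mult_ac)
  have "fst (Psi (J, E)) = mass_G w m"
    unfolding Psi_def mass_G_def kk[symmetric] by (simp add: M kA)
  moreover have "snd (Psi (J, E)) = momentum_G w m"
  proof -
    have "J = sqrt (a * b * c / 2)" using JE unfolding Phi_map_def Rab(3) unfolding Rab(1,2) by simp
    also have "a * b * c / 2 = A^2 * (w * (w + 1) * (w + m)) / (2 / A)"
      unfolding a_def b_def c_def using A by (simp add: power2_eq_square algebra_simps)
    also have "sqrt \<dots> = A * sqrt (w * (w + 1) * (w + m)) / k"
      unfolding k_def real_sqrt_divide[of _ "2 / A"] real_sqrt_mult[of "A^2"] using A by simp
    finally have "J * k = A * sqrt (w * (w + 1) * (w + m))" using kk wm by simp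
    then have "momentum_P J E = A * sqrt (w * (w + 1) * (w + m)) * ellK m"
      unfolding momentum_P_def T by (simp flip: mult.assoc)
    then show ?thesis unfolding Psi_def momentum_G_def A_def by simp
  qed
  ultimately show ?thesis unfolding JE unfolding G_map_def p by (simp add: prod_eq_iff)
qed

lemma open_D_tilde: "open D_tilde"
proof -
  have "D_tilde = {p. 0 < fst p \<and> 0 < snd p \<and> snd p < fst p / pi *
      sqrt (3 * (fst p)^2 + pi^2 - sqrt (9 * (fst p)^4 + 4 * (fst p)^2 * pi^2))}"
    unfolding D_tilde_def by auto
  also have "open \<dots>"
    by (intro open_Collect_conj open_Collect_less continuous_intros) auto
  finally show ?thesis .
qed

text \<open>The bounds of \<open>D1\<close> are definite descriptions, so openness is taken from
  invariance of domain for \<open>Phi_map\<close> instead of from continuity of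
  \<open>E_minus\<close> and \<open>E_plus\<close>.\<close>

lemma open_D1: "open D1"
proof -
  have d: "inj_on Phi_map Sigma_dom" "Phi_map ` Sigma_dom = D1" "smooth_on Sigma_dom Phi_map"
    using diffeomorphism_on_Phi_map unfolding diffeomorphism_on_def by blast+
  then show ?thesis
    using invariance_of_domain[OF smooth_on_imp_continuous_on[OF d(3)] open_Sigma_dom d(1)] by simp
qed

theorem theorem6:
  shows "diffeomorphism_on D1 D_tilde Psi"
proof (rule diffeomorphism_on_compose_inverse[OF open_D1 open_D_tilde _ diffeomorphism_on_Phi_map])
  \<comment> \<open>The coordinate changes are undone one at a time: \<open>R_map\<close> here,
    \<open>Phi_map\<close> in the enclosing step.\<close>
  show "diffeomorphism_on Sigma_dom D_tilde (\<lambda>s. Psi (Phi_map s))"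
    by (rule diffeomorphism_on_compose_inverse[OF open_Sigma_dom open_D_tilde
          diffeomorphism_on_G_map diffeomorphism_on_R_map Psi_Phi_R_map])
qed simp

end
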